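(* Let $T$ be a cycle-tree of a signed graph. Then $T$ satisfies the Parity Condition if and only if there exists a direction $\varepsilon_T$ on $T$, and in that case the direction is unique up to opposite sign.
   Context: A signed graph is a finite graph (loops, multiple edges allowed) with edge signs $\sigma(e)\in\{\pm1\}$. A cycle is a simple closed path (a loop is a cycle); it is balanced if the product of its edge signs is $+1$, unbalanced otherwise. An orientation of a signed subgraph assigns $\varepsilon(v,e)\in\{\pm1\}$ to each pair with $v$ an end-vertex of $e$, with $\varepsilon(u,e)\varepsilon(v,e)=-\sigma(e)$ for $e=uv$ (for a positive loop both values $\pm1$ occur); $+1$ means the arrow points away from $v$. A sink (source) is a vertex all of whose arrows point toward (away from) it. A cut-point is a vertex whose removal increases the number of connected components. A cycle-tree is a connected signed subgraph $T$ decomposed into edge-disjoint cycles (block cycles) and vertex-disjoint simple paths (block paths, possibly of length zero) such that: the block cycles are all the cycles of $T$; two block cycles share at most one vertex (an intersection vertex); each block path meets exactly two block cycles, exactly at its two end-vertices (also intersection vertices); every intersection vertex is a cut-point of $T$. The Parity Condition: each balanced block cycle has an even number of intersection vertices and each unbalanced block cycle an odd number. A direction of $T$ is an orientation $\varepsilon_T$ of $T$ such that $(T,\varepsilon_T)$ has neither sink nor source, and for each block cycle $C$, the restriction of $\varepsilon_T$ to $C$ has a sink or a source at each cut-point of $T$ lying on $C$.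
   Formalization: A vertex shared by two block cycles is required to be a block path of length zero, so at most two block cycles pass through any vertex; otherwise three unbalanced cycles at one common vertex satisfy the Parity Condition but have three directions up to sign. *)

theory Defs
  imports Main
begin

section \<open>Signed graphs\<close>

text \<open>
  Every edge \<open>e\<close> has two ends, labelled by the Booleans: the pairs \<open>(e, b)\<close> are the half-edges of
  the graph, and \<open>endpt G e b\<close> is the vertex at which the half-edge \<open>(e, b)\<close> is attached.
  The labelling has no meaning beyond distinguishing the two ends.  A loop has both half-edges at
  one vertex; parallel edges are distinct elements of \<open>edges G\<close> with the same end-vertices.
\<close>

record ('v, 'e) sgraph =
  verts :: "'v set"
  edges :: "'e set"
  endpt :: "'e \<Rightarrow> bool \<Rightarrow> 'v"
  sign  :: "'e \<Rightarrow> int"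

definition ends :: "('v, 'e) sgraph \<Rightarrow> 'e \<Rightarrow> 'v set" where
  "ends G e = range (endpt G e)"

definition signed_graph :: "('v, 'e) sgraph \<Rightarrow> bool" where
  "signed_graph G \<longleftrightarrow> finite (verts G) \<and> finite (edges G) \<and>
     (\<forall>e\<in>edges G. ends G e \<subseteq> verts G \<and> sign G e \<in> {1, -1})"

definition signed_subgraph :: "('v, 'e) sgraph \<Rightarrow> ('v, 'e) sgraph \<Rightarrow> bool" where
  "signed_subgraph H G \<longleftrightarrow> signed_graph H \<and> verts H \<subseteq> verts G \<and> edges H \<subseteq> edges G \<and>
     (\<forall>e\<in>edges H. endpt H e = endpt G e \<and> sign H e = sign G e)"


section \<open>Paths and cycles\<close>

definition walk :: "('v, 'e) sgraph \<Rightarrow> 'v list \<Rightarrow> 'e list \<Rightarrow> bool" where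
  "walk G vs es \<longleftrightarrow> length vs = Suc (length es) \<and> set vs \<subseteq> verts G \<and> set es \<subseteq> edges G \<and>
     (\<forall>i<length es. \<exists>b. endpt G (es ! i) b = vs ! i \<and> endpt G (es ! i) (\<not> b) = vs ! Suc i)"

text \<open>The path of length zero at \<open>v\<close> is given by \<open>vs = [v]\<close> and \<open>es = []\<close>.\<close>

definition simple_path :: "('v, 'e) sgraph \<Rightarrow> 'v list \<Rightarrow> 'e list \<Rightarrow> bool" where
  "simple_path G vs es \<longleftrightarrow> walk G vs es \<and> distinct vs"

definition simple_closed_path :: "('v, 'e) sgraph \<Rightarrow> 'v list \<Rightarrow> 'e list \<Rightarrow> bool" where
  "simple_closed_path G vs es \<longleftrightarrow>
     walk G vs es \<and> es \<noteq> [] \<and> hd vs = last vs \<and> distinct (tl vs) \<and> distinct es"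

text \<open>
  A cycle is identified with its set of edges, so that its starting point and the sense in which
  it is traversed do not matter; \<open>vertices_of\<close> recovers its vertices.
\<close>

definition is_cycle :: "('v, 'e) sgraph \<Rightarrow> 'e set \<Rightarrow> bool" where
  "is_cycle G C \<longleftrightarrow> (\<exists>vs es. simple_closed_path G vs es \<and> C = set es)"

definition vertices_of :: "('v, 'e) sgraph \<Rightarrow> 'e set \<Rightarrow> 'v set" where
  "vertices_of G C = (\<Union>e\<in>C. ends G e)"

definition balanced :: "('v, 'e) sgraph \<Rightarrow> 'e set \<Rightarrow> bool" where
  "balanced G C \<longleftrightarrow> (\<Prod>e\<in>C. sign G e) = 1"


section \<open>Connected components and cut-points\<close>

text \<open>
  Components are the classes of vertices and edges generated by incidence.  Allowing \<open>E\<close> to contain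
  edges with an end outside \<open>V\<close> makes it possible to remove a vertex as a point.
\<close>

definition incidence ::
    "('v, 'e) sgraph \<Rightarrow> 'v set \<Rightarrow> 'e set \<Rightarrow> (('v + 'e) \<times> ('v + 'e)) set" where
  "incidence G V E = {(Inl u, Inr e) | u e. u \<in> V \<and> e \<in> E \<and> u \<in> ends G e}"

definition components :: "('v, 'e) sgraph \<Rightarrow> 'v set \<Rightarrow> 'e set \<Rightarrow> ('v + 'e) set set" where
  "components G V E = (V <+> E) // (incidence G V E \<union> (incidence G V E)\<inverse>)\<^sup>*"

definition connected_graph :: "('v, 'e) sgraph \<Rightarrow> bool" where
  "connected_graph G \<longleftrightarrow> card (components G (verts G) (edges G)) = 1"

text \<open>
  Removing \<open>v\<close> means removing the point \<open>v\<close>: the edges at \<open>v\<close> stay, as open edges that have lost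
  their end at \<open>v\<close>.  A link at \<open>v\<close> then remains attached to its other end, and contributes no
  component, so that for a vertex without loops the edges at \<open>v\<close> may equally well be deleted
  (\<open>cut_point_iff_deletion\<close> below).  A loop at \<open>v\<close> becomes a component of its own.  If loops were
  deleted instead, the vertex of a loop that serves as a block cycle could never be a cut-point,
  and for example two negative loops at a common vertex would not form a cycle-tree.
\<close>

definition cut_point :: "('v, 'e) sgraph \<Rightarrow> 'v \<Rightarrow> bool" where
  "cut_point G v \<longleftrightarrow> v \<in> verts G \<and>
     card (components G (verts G - {v}) (edges G)) > card (components G (verts G) (edges G))"

lemma cut_point_iff_deletion:
  assumes G: "signed_graph G" and no_loop: "\<forall>e\<in>edges G. ends G e \<noteq> {v}"
  shows "cut_point G v \<longleftrightarrow> v \<in> verts G \<and>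
           card (components G (verts G - {v}) {e \<in> edges G. v \<notin> ends G e})
             > card (components G (verts G) (edges G))"
proof -
  define V where "V = verts G - {v}"
  define E where "E = edges G"
  define E' where "E' = {e \<in> edges G. v \<notin> ends G e}"
  define r where "r = (incidence G V E \<union> (incidence G V E)\<inverse>)\<^sup>*"
  define r' where "r' = (incidence G V E' \<union> (incidence G V E')\<inverse>)\<^sup>*"
  have sym: "sym r" "sym r'"
    unfolding r_def r'_def by (intro sym_rtrancl sym_Un_converse)+
  have trans: "trans r" "trans r'" unfolding r_def r'_def by (rule trans_rtrancl)+
  have refl: "(x, x) \<in> r" "(x, x) \<in> r'" for x unfolding r_def r'_def by auto
  have E'E: "E' \<subseteq> E" unfolding E_def E'_def by auto
  have sub: "r' \<subseteq> r"
    unfolding r_def r'_def using E'E by (intro rtrancl_mono) (auto simp: incidence_def)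
  have ends_V: "\<exists>u\<in>V. u \<in> ends G e" if "e \<in> E" for e
  proof -
    have "ends G e \<subseteq> verts G" "ends G e \<noteq> {v}" "ends G e \<noteq> {}"
      using that G no_loop unfolding E_def signed_graph_def ends_def by auto
    then show ?thesis unfolding V_def by blast
  qed
  have link: "(Inl w, Inl w') \<in> r'" 
    if prems: "e \<in> E" "w \<in> V" "w' \<in> V" "w \<in> ends G e" "w' \<in> ends G e" for e w w'
  proof (cases "w = w'")
    case True then show ?thesis using refl by simp
  next
    case False
    obtain b c where b: "endpt G e b = w" "endpt G e c = w'" using prems(4,5) unfolding ends_def by blast
    with False have "c = (\<not> b)" by (cases b; cases c) auto
    then have "ends G e = {w, w'}" unfolding ends_def UNIV_bool using b by (cases b) auto
    then have "e \<in> E'" using that unfolding E_def E'_def V_def by auto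
    then have "(Inl w, Inr e) \<in> incidence G V E'" "(Inl w', Inr e) \<in> incidence G V E'"
      using that unfolding incidence_def by auto
    then show ?thesis unfolding r'_def
      by (meson UnI1 UnI2 converseI r_into_rtrancl rtrancl_trans)
  qed
  have inv: "(\<forall>w. y = Inl w \<longrightarrow> (Inl u, Inl w) \<in> r') \<and>
      (\<forall>e w. y = Inr e \<longrightarrow> w \<in> V \<longrightarrow> w \<in> ends G e \<longrightarrow> (Inl u, Inl w) \<in> r')"
    if "(Inl u, y) \<in> r" for u y
    using that[unfolded r_def]
  proof (induction rule: rtrancl_induct)
    case base
    then show ?case using refl by auto
  next
    case (step y z)
    from step.hyps(2) show ?case
    proof
      assume "(y, z) \<in> incidence G V E"
      then obtain w e where we: "y = Inl w" "z = Inr e" "w \<in> V" "e \<in> E" "w \<in> ends G e"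
        unfolding incidence_def by auto
      have "(Inl u, Inl w) \<in> r'" using step.IH we by auto
      moreover have "(Inl w, Inl w') \<in> r'" if "w' \<in> V" "w' \<in> ends G e" for w'
        using link we that by blast
      ultimately show ?thesis using we transD[OF trans(2)] by blast
    next
      assume "(y, z) \<in> (incidence G V E)\<inverse>"
      then show ?thesis using step.IH unfolding incidence_def by auto
    qed
  qed
  have iff: "(Inl u, Inl w) \<in> r \<longleftrightarrow> (Inl u, Inl w) \<in> r'" for u w
    using inv sub by blast
  have cls: "r `` {x} = r `` {y} \<longleftrightarrow> (x, y) \<in> r" "r' `` {x} = r' `` {y} \<longleftrightarrow> (x, y) \<in> r'" for x y
    by (intro eq_equiv_class_iff[of UNIV] equivI sym trans; simp add: refl refl_on_def)+
  have rep: "Inr ` E \<subseteq> (\<Union>u\<in>V. r `` {Inl u})"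
  proof clarify
    fix e assume "e \<in> E"
    then obtain u where "u \<in> V" "u \<in> ends G e" using ends_V by blast
    then have "(Inl u, Inr e) \<in> r" using \<open>e \<in> E\<close> unfolding r_def incidence_def by blast
    then show "Inr e \<in> (\<Union>u\<in>V. r `` {Inl u})" using \<open>u \<in> V\<close> by blast
  qed
  have rep': "Inr ` E' \<subseteq> (\<Union>u\<in>V. r' `` {Inl u})"
  proof clarify
    fix e assume "e \<in> E'"
    then obtain u where "u \<in> V" "u \<in> ends G e" using ends_V E'E by blast
    then have "(Inl u, Inr e) \<in> r'" using \<open>e \<in> E'\<close> unfolding r'_def incidence_def by blast
    then show "Inr e \<in> (\<Union>u\<in>V. r' `` {Inl u})" using \<open>u \<in> V\<close> by blast
  qed
  have "components G V E = (\<lambda>u. r `` {Inl u}) ` V"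
  proof -
    have "components G V E = (\<lambda>x. r `` {x}) ` (V <+> E)"
      unfolding components_def r_def[symmetric] quotient_def by auto
    moreover have "r `` {Inr e} \<in> (\<lambda>u. r `` {Inl u}) ` V" if e: "e \<in> E" for e
    proof -
      obtain u where u: "u \<in> V" "(Inl u, Inr e) \<in> r" using rep e by blast
      then show ?thesis using cls(1)[of "Inl u" "Inr e"] by blast
    qed
    ultimately show ?thesis unfolding Plus_def by (auto simp: image_Un image_image)
  qed
  moreover have "components G V E' = (\<lambda>u. r' `` {Inl u}) ` V"
  proof -
    have "components G V E' = (\<lambda>x. r' `` {x}) ` (V <+> E')"
      unfolding components_def r'_def[symmetric] quotient_def by auto
    moreover have "r' `` {Inr e} \<in> (\<lambda>u. r' `` {Inl u}) ` V" if e: "e \<in> E'" for e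
    proof -
      obtain u where u: "u \<in> V" "(Inl u, Inr e) \<in> r'" using rep' e by blast
      then show ?thesis using cls(2)[of "Inl u" "Inr e"] by blast
    qed
    ultimately show ?thesis unfolding Plus_def by (auto simp: image_Un image_image)
  qed
  moreover have "card ((\<lambda>u. r `` {Inl u}) ` V) = card ((\<lambda>u. r' `` {Inl u}) ` V)"
  proof -
    have *: "card (f ` V) \<le> card (g ` V)" if "finite V" "\<And>u w. f u = f w \<longleftrightarrow> g u = g w"
      for f g :: "'a \<Rightarrow> ('a + 'b) set"
    proof -
      have "f (SOME w. g w = g u) = f u" for u
        using that(2) someI[of "\<lambda>w. g w = g u" u] by simp
      then have "f ` V = (\<lambda>X. f (SOME w. g w = X)) ` g ` V"
        unfolding image_image by simp
      then show ?thesis using card_image_le[of "g ` V"] that(1) by simp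
    qed
    have "finite V" using G unfolding V_def signed_graph_def by auto
    then show ?thesis
      by (intro antisym *) (simp_all add: cls iff)
  qed
  ultimately show ?thesis
    unfolding cut_point_def V_def E_def E'_def by simp
qed


section \<open>Cycle-trees\<close>

text \<open>
  \<open>Cs\<close> is the set of block cycles and \<open>Ps\<close> the set of block paths, each path given by its
  list of vertices and its list of edges.
\<close>

definition intersection_vertices ::
    "('v, 'e) sgraph \<Rightarrow> 'e set set \<Rightarrow> ('v list \<times> 'e list) set \<Rightarrow> 'v set" where
  "intersection_vertices T Cs Ps =
     {v. \<exists>C\<in>Cs. \<exists>D\<in>Cs. C \<noteq> D \<and> v \<in> vertices_of T C \<inter> vertices_of T D} \<union>
     {v. \<exists>(vs, es)\<in>Ps. v = hd vs \<or> v = last vs}"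

text \<open>
  Block paths of length zero are part of the decomposition: a vertex common to two block cycles is
  a block path of length zero.  As a block path meets exactly two block cycles, and distinct block
  paths are vertex-disjoint, no third block cycle and no other block path passes through such a
  vertex.
\<close>

definition cycle_tree ::
    "('v, 'e) sgraph \<Rightarrow> 'e set set \<Rightarrow> ('v list \<times> 'e list) set \<Rightarrow> bool" where
  "cycle_tree T Cs Ps \<longleftrightarrow>
     connected_graph T \<and>
     \<comment> \<open>decomposition into edge-disjoint cycles and vertex-disjoint simple paths\<close>
     (\<forall>(vs, es)\<in>Ps. simple_path T vs es) \<and>
     pairwise disjnt Cs \<and>
     (\<forall>(vs, es)\<in>Ps. \<forall>(vs', es')\<in>Ps. (vs, es) \<noteq> (vs', es') \<longrightarrow> set vs \<inter> set vs' = {}) \<and>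
     (\<forall>C\<in>Cs. \<forall>(vs, es)\<in>Ps. C \<inter> set es = {}) \<and>
     edges T = \<Union>Cs \<union> (\<Union>(vs, es)\<in>Ps. set es) \<and>
     verts T = (\<Union>C\<in>Cs. vertices_of T C) \<union> (\<Union>(vs, es)\<in>Ps. set vs) \<and>
     \<comment> \<open>the block cycles are all the cycles\<close>
     Cs = {C. is_cycle T C} \<and>
     \<comment> \<open>two block cycles share at most one vertex, which is then a block path of length zero\<close>
     (\<forall>C\<in>Cs. \<forall>D\<in>Cs. C \<noteq> D \<longrightarrow>
        vertices_of T C \<inter> vertices_of T D = {} \<or>
        (\<exists>v. vertices_of T C \<inter> vertices_of T D = {v} \<and> ([v], []) \<in> Ps)) \<and>
     \<comment> \<open>each block path meets exactly two block cycles, exactly at its two end-vertices\<close>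
     (\<forall>(vs, es)\<in>Ps. \<exists>C\<in>Cs. \<exists>D\<in>Cs. C \<noteq> D \<and>
        vertices_of T C \<inter> set vs = {hd vs} \<and> vertices_of T D \<inter> set vs = {last vs} \<and>
        (\<forall>B\<in>Cs - {C, D}. vertices_of T B \<inter> set vs = {})) \<and>
     (\<forall>v\<in>intersection_vertices T Cs Ps. cut_point T v)"

definition parity_condition ::
    "('v, 'e) sgraph \<Rightarrow> 'e set set \<Rightarrow> ('v list \<times> 'e list) set \<Rightarrow> bool" where
  "parity_condition T Cs Ps \<longleftrightarrow>
     (\<forall>C\<in>Cs. (balanced T C \<longrightarrow> even (card (vertices_of T C \<inter> intersection_vertices T Cs Ps))) \<and>
              (\<not> balanced T C \<longrightarrow> odd (card (vertices_of T C \<inter> intersection_vertices T Cs Ps))))"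


section \<open>Orientations and directions\<close>

text \<open>
  An orientation gives an arrow to every half-edge; \<open>1\<close> means that the arrow points away from the
  vertex at which the half-edge is attached.  Thus a positive loop carries both values at its
  vertex, and a negative loop carries the same value twice.
\<close>

definition orientation :: "('v, 'e) sgraph \<Rightarrow> ('e \<Rightarrow> bool \<Rightarrow> int) \<Rightarrow> bool" where
  "orientation G \<epsilon> \<longleftrightarrow>
     (\<forall>e\<in>edges G. (\<forall>b. \<epsilon> e b \<in> {1, -1}) \<and> \<epsilon> e False * \<epsilon> e True = - sign G e)"

definition sink_on :: "('v, 'e) sgraph \<Rightarrow> ('e \<Rightarrow> bool \<Rightarrow> int) \<Rightarrow> 'e set \<Rightarrow> 'v \<Rightarrow> bool" where
  "sink_on G \<epsilon> E v \<longleftrightarrow> (\<forall>e\<in>E. \<forall>b. endpt G e b = v \<longrightarrow> \<epsilon> e b = -1)"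

definition source_on :: "('v, 'e) sgraph \<Rightarrow> ('e \<Rightarrow> bool \<Rightarrow> int) \<Rightarrow> 'e set \<Rightarrow> 'v \<Rightarrow> bool" where
  "source_on G \<epsilon> E v \<longleftrightarrow> (\<forall>e\<in>E. \<forall>b. endpt G e b = v \<longrightarrow> \<epsilon> e b = 1)"

definition direction ::
    "('v, 'e) sgraph \<Rightarrow> 'e set set \<Rightarrow> ('e \<Rightarrow> bool \<Rightarrow> int) \<Rightarrow> bool" where
  "direction T Cs \<epsilon> \<longleftrightarrow>
     orientation T \<epsilon> \<and>
     (\<forall>v\<in>verts T. \<not> sink_on T \<epsilon> (edges T) v \<and> \<not> source_on T \<epsilon> (edges T) v) \<and>
     (\<forall>C\<in>Cs. \<forall>v\<in>vertices_of T C. cut_point T v \<longrightarrow> sink_on T \<epsilon> C v \<or> source_on T \<epsilon> C v)"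

text \<open>Only the values on the edges of \<open>T\<close> are part of an orientation of \<open>T\<close>.\<close>

definition same_orientation ::
    "('v, 'e) sgraph \<Rightarrow> ('e \<Rightarrow> bool \<Rightarrow> int) \<Rightarrow> ('e \<Rightarrow> bool \<Rightarrow> int) \<Rightarrow> bool" where
  "same_orientation T \<epsilon> \<epsilon>' \<longleftrightarrow> (\<forall>e\<in>edges T. \<forall>b. \<epsilon> e b = \<epsilon>' e b)"

end

theory Submission
  imports Defs
begin

text \<open>
  On a cycle-tree, a direction is the same as an orientation satisfying local rules: two half-edges
  of one block carry equal arrows at an intersection vertex and opposite arrows elsewhere, and
  half-edges of different blocks carry opposite arrows.  The product of all arrows of a block cycle
  shows that the rules can be met inside the cycle iff the Parity Condition holds there; a block
  path imposes no condition.  The solutions inside the blocks are then glued together with the help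
  of the cut-points.  Since the rules fix the product of any two arrows at a vertex or on an edge,
  connectedness gives uniqueness up to opposite sign.
\<close>

text \<open>The sign in the Parity Condition comes from a count. A block cycle with \<open>n\<close>
  edges has \<open>n\<close> vertices; let \<open>k\<close> of them be intersection vertices. The
  product of all its arrows is \<open>(-1)^n\<close> times the sign of the cycle when taken edge by
  edge, and \<open>(-1)^(n-k)\<close> when taken vertex by vertex. Equality says that the cycle has
  sign \<open>(-1)^k\<close>. A direction constrains a block cycle at cut-points, whereas the Parity
  Condition counts intersection vertices, so both notions have to be identified on block cycles. The
  rules become local because exactly two blocks meet at an intersection vertex and only one block
  passes through any other vertex; the block paths of length zero are what excludes a third cycle at
  a common vertex. The gluing does not run inductively along the tree of blocks: all reversals are
  performed at once, as a product of signs, so that no order of the blocks has to be built. Arrows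
  are compared by half-edge and never by edge, so that loops need no separate treatment.\<close>

section \<open>Chains of edges\<close>

text \<open>One encoding serves paths and cycles: \<open>v\<close> is injective on the indices below
  \<open>n\<close> and, shifted, on \<open>1\<close> to \<open>n\<close>, which leaves
  \<open>v n = v 0\<close> possible. The Boolean \<open>b i\<close> is the end at which
  \<open>e i\<close> is entered; on a loop the vertices alone would not tell the two half-edges
  apart.\<close>

definition edge_chain ::
    "('v, 'e) sgraph \<Rightarrow> nat \<Rightarrow> (nat \<Rightarrow> 'v) \<Rightarrow> (nat \<Rightarrow> 'e) \<Rightarrow> (nat \<Rightarrow> bool) \<Rightarrow> bool" where
  "edge_chain G n v e b \<longleftrightarrow> inj_on e {..<n} \<and> inj_on v {..<n} \<and> inj_on (\<lambda>i. v (Suc i)) {..<n} \<and>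
     (\<forall>i<n. e i \<in> edges G \<and> endpt G (e i) (b i) = v i \<and> endpt G (e i) (\<not> b i) = v (Suc i))"

lemma walk_sides:
  assumes "walk G vs es"
  obtains b where "\<And>i. i < length es \<Longrightarrow>
    endpt G (es ! i) (b i) = vs ! i \<and> endpt G (es ! i) (\<not> b i) = vs ! Suc i"
  using assms unfolding walk_def by metis

lemma path_chain:
  assumes "simple_path G vs es"
  obtains b where "edge_chain G (length es) ((!) vs) ((!) es) b" "inj_on ((!) vs) {..length es}"
proof -
  have w: "walk G vs es" and d: "distinct vs" using assms unfolding simple_path_def by auto
  have len: "length vs = Suc (length es)" and E: "set es \<subseteq> edges G" using w unfolding walk_def by auto
  obtain b where b: "\<And>i. i < length es \<Longrightarrow>
    endpt G (es ! i) (b i) = vs ! i \<and> endpt G (es ! i) (\<not> b i) = vs ! Suc i"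
    using walk_sides[OF w] by blast
  have inj: "inj_on ((!) vs) {..length es}"
    using d len by (auto simp: inj_on_def nth_eq_iff_index_eq)
  \<comment> \<open>A simple path is only given with distinct vertices. A repeated edge would repeat
    its pair of ends, in the same or in the opposite order, and neither is possible for two
    different positions.\<close>
  have "inj_on ((!) es) {..<length es}"
  proof (rule inj_onI)
    fix i j assume ij: "i \<in> {..<length es}" "j \<in> {..<length es}" "es ! i = es ! j"
    consider "b i = b j" | "b i = (\<not> b j)" by blast
    then have "vs ! i = vs ! j \<or> vs ! i = vs ! Suc j \<and> vs ! Suc i = vs ! j"
    proof cases
      case 1 then show ?thesis using b[of i] b[of j] ij by auto
    next
      case 2 then show ?thesis using b[of i] b[of j] ij by auto
    qed
    then have "i = j \<or> i = Suc j \<and> Suc i = j" using inj ij(1,2) by (auto simp: inj_on_def)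
    then show "i = j" by linarith
  qed
  moreover have "inj_on ((!) vs) {..<length es}" using inj by (rule inj_on_subset) auto
  moreover have "inj_on (\<lambda>i. vs ! Suc i) {..<length es}"
    using inj_onD[OF inj] by (fastforce intro: inj_onI)
  ultimately have "edge_chain G (length es) ((!) vs) ((!) es) b"
    using b E unfolding edge_chain_def by (auto simp: subset_iff)
  then show ?thesis using inj that by blast
qed

lemma cycle_chain:
  assumes "is_cycle G C"
  obtains n v e b where "0 < n" "edge_chain G n v e b" "v n = v 0" "C = e ` {..<n}"
proof -
  obtain vs es where p: "simple_closed_path G vs es" "C = set es"
    using assms unfolding is_cycle_def by auto
  then have w: "walk G vs es" and ne: "es \<noteq> []" and hl: "hd vs = last vs" and d: "distinct (tl vs)"
    and de: "distinct es"
    unfolding simple_closed_path_def by auto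
  define n where "n = length es"
  have len: "length vs = Suc n" and E: "set es \<subseteq> edges G"
    using w unfolding walk_def n_def by auto
  obtain b where b: "\<And>i. i < length es \<Longrightarrow>
    endpt G (es ! i) (b i) = vs ! i \<and> endpt G (es ! i) (\<not> b i) = vs ! Suc i"
    using walk_sides[OF w] by blast
  have n: "0 < n" using ne n_def by simp
  have close: "vs ! n = vs ! 0"
    using hl len by (metis hd_conv_nth last_conv_nth length_0_conv nat.distinct(1) diff_Suc_1)
  have injS: "inj_on (\<lambda>i. vs ! Suc i) {..<n}"
    using d len by (auto simp: inj_on_def nth_tl distinct_conv_nth)
  have "inj_on ((!) vs) {..<n}"
  proof (rule inj_onI)
    fix i j assume ij: "i \<in> {..<n}" "j \<in> {..<n}" "vs ! i = vs ! j"
    \<comment> \<open>The cyclic predecessor: \<open>distinct (tl vs)\<close> speaks of the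
      positions \<open>1\<close> to \<open>n\<close>, and \<open>p\<close> carries this over to the
      positions \<open>0\<close> to \<open>n - 1\<close>.\<close>
    define p where "p k = (if k = 0 then n - 1 else k - 1)" for k
    have p: "vs ! Suc (p k) = vs ! k" "p k < n" if "k < n" for k
      using close n that by (auto simp: p_def)
    have "p i = p j" using injS p ij by (auto simp: inj_on_def)
    then show "i = j" using ij(1,2) by (auto simp: p_def split: if_splits)
  qed
  moreover have "inj_on ((!) es) {..<n}" using de by (auto simp: inj_on_def n_def nth_eq_iff_index_eq)
  ultimately have "edge_chain G n ((!) vs) ((!) es) b"
    using b E injS unfolding edge_chain_def n_def by (auto simp: subset_iff)
  moreover have "C = (!) es ` {..<n}"
    using p(2) by (auto simp: n_def set_conv_nth)
  ultimately show ?thesis using that n close by blast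
qed

lemma chain_half_edge:
  assumes "edge_chain G n v e b" "x \<in> e ` {..<n}" "endpt G x c = w"
  obtains i where "i < n" "x = e i" "c = b i" "w = v i"
    | i where "i < n" "x = e i" "c = (\<not> b i)" "w = v (Suc i)"
proof -
  obtain i where "i < n" "x = e i" using assms(2) by auto
  then show ?thesis using assms that unfolding edge_chain_def by (cases "c = b i") auto
qed

text \<open>Of three half-edges at a vertex, two are both initial or both final in the chain.\<close>

lemma chain_half_edges_le_2:
  assumes ch: "edge_chain G n v e b" and "x \<in> e ` {..<n}" "y \<in> e ` {..<n}" "z \<in> e ` {..<n}"
    and "endpt G x bx = w" "endpt G y by' = w" "endpt G z bz = w"
  shows "(x, bx) = (y, by') \<or> (x, bx) = (z, bz) \<or> (y, by') = (z, bz)"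
proof -
  have inj: "i = j" if "v i = v j" "i < n" "j < n" for i j
    using ch that unfolding edge_chain_def inj_on_def by auto
  have injS: "i = j" if "v (Suc i) = v (Suc j)" "i < n" "j < n" for i j
    using ch that unfolding edge_chain_def inj_on_def by auto
  define P where "P h \<longleftrightarrow> (\<exists>i<n. h = (e i, b i) \<and> w = v i)" for h
  define Q where "Q h \<longleftrightarrow> (\<exists>i<n. h = (e i, \<not> b i) \<and> w = v (Suc i))" for h
  have "h = h'" if "P h" "P h'" for h h' using that inj unfolding P_def by blast
  moreover have "h = h'" if "Q h" "Q h'" for h h' using that injS unfolding Q_def by blast
  moreover have "P (x, c) \<or> Q (x, c)" if "x \<in> e ` {..<n}" "endpt G x c = w" for x c
    by (rule chain_half_edge[OF ch that]) (auto simp: P_def Q_def)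
  ultimately show ?thesis using assms(2-) by metis
qed

text \<open>The vertex rule is a prescribed product: the value \<open>1\<close> of
  \<open>\<tau>\<close> asks for equal arrows, \<open>-1\<close> for opposite ones. It ranges over
  pairs of distinct half-edges, so the two ends of a loop are compared as well. Products make the
  rule insensitive to reversing all arrows of \<open>E\<close>.\<close>

definition follows ::
    "('v, 'e) sgraph \<Rightarrow> 'e set \<Rightarrow> ('v \<Rightarrow> int) \<Rightarrow> ('e \<Rightarrow> bool \<Rightarrow> int) \<Rightarrow> bool" where
  "follows G E \<tau> \<epsilon> \<longleftrightarrow>
     (\<forall>e\<in>E. (\<forall>b. \<epsilon> e b \<in> {1, -1}) \<and> \<epsilon> e False * \<epsilon> e True = - sign G e) \<and>
     (\<forall>e\<in>E. \<forall>e'\<in>E. \<forall>b b'. (e, b) \<noteq> (e', b') \<longrightarrow> endpt G e b = endpt G e' b' \<longrightarrow>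
        \<epsilon> e b * \<epsilon> e' b' = \<tau> (endpt G e b))"

section \<open>Solving the arrow rules along a chain, and the product around a cycle\<close>

lemma prod_shift_closed:
  fixes f :: "nat \<Rightarrow> int"
  assumes "f n = f 0"
  shows "(\<Prod>i<n. f (Suc i)) = (\<Prod>i<n. f i)"
proof (cases n)
  case (Suc m)
  have "(\<Prod>i<Suc m. f i) = f 0 * (\<Prod>i<m. f (Suc i))" by (rule prod.lessThan_Suc_shift)
  then show ?thesis using assms Suc by simp
qed simp

lemma unit_sq: "(x :: int) \<in> {1, -1} \<Longrightarrow> x * x = 1" by auto

text \<open>The first arrow is chosen as \<open>1\<close> and the rules determine all others by
  propagation. An open chain never returns to a vertex, so nothing can go wrong; on a closed chain
  one constraint remains, at the vertex where it closes, and the product identity in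
  \<open>bd\<close> is exactly that constraint.\<close>

lemma chain_follows:
  fixes \<tau> :: "'v \<Rightarrow> int"
  assumes ch: "edge_chain G n v e b"
    and sg: "\<And>x. x \<in> edges G \<Longrightarrow> sign G x \<in> {1, -1}" and \<tau>: "\<And>w. \<tau> w \<in> {1, -1}"
    and bd: "v n \<notin> v ` {..<n} \<or> v n = v 0 \<and> (\<Prod>i<n. - sign G (e i)) = (\<Prod>i<n. \<tau> (v i))"
  shows "\<exists>\<epsilon>. follows G (e ` {..<n}) \<tau> \<epsilon>"
proof -
  \<comment> \<open>\<open>a i\<close> is the arrow forced on the initial half-edge of
    \<open>e i\<close>: crossing \<open>e j\<close> multiplies by \<open>- sign G (e j)\<close>,
    passing its final vertex multiplies by the prescribed product there.\<close>
  define a where "a i = (\<Prod>j<i. - sign G (e j) * \<tau> (v (Suc j)))" for i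
  define \<epsilon> where "\<epsilon> x c = (let i = the_inv_into {..<n} e x in
    if c = b i then a i else - sign G x * a i)" for x c
  have inj_e: "inj_on e {..<n}" using ch unfolding edge_chain_def by simp
  have inj: "i = j" if "v i = v j" "i < n" "j < n" for i j
    using ch that unfolding edge_chain_def inj_on_def by auto
  have injS: "i = j" if "v (Suc i) = v (Suc j)" "i < n" "j < n" for i j
    using ch that unfolding edge_chain_def inj_on_def by auto
  have sge: "sign G (e i) \<in> {1, -1}" if "i < n" for i using ch sg that unfolding edge_chain_def by auto
  have aS: "a (Suc i) = a i * (- sign G (e i) * \<tau> (v (Suc i)))" for i by (simp add: a_def)
  have au: "a i \<in> {1, -1}" if "i \<le> n" for i
    using that
  proof (induction i)
    case 0 then show ?case by (simp add: a_def)
  next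
    case (Suc i)
    have "a i \<in> {1, -1}" "sign G (e i) \<in> {1, -1}" "\<tau> (v (Suc i)) \<in> {1, -1}"
      using Suc sge \<tau> by auto
    then show ?case unfolding aS by auto
  qed
  have out: "\<epsilon> (e i) (b i) = a i" and inn: "\<epsilon> (e i) (\<not> b i) = - sign G (e i) * a i" if "i < n" for i
    using that inj_e by (auto simp: \<epsilon>_def the_inv_into_f_f)
  have join: "\<epsilon> (e i) (\<not> b i) * \<epsilon> (e j) (b j) = \<tau> (v j)" if "v (Suc i) = v j" "i < n" "j < n" for i j
  proof (cases "Suc i < n")
    case True
    then have "j = Suc i" using inj[of "Suc i" j] that by simp
    have "\<epsilon> (e i) (\<not> b i) * \<epsilon> (e j) (b j) = - sign G (e i) * a i * a (Suc i)"
      by (simp only: inn[OF that(2)] out[OF that(3), unfolded \<open>j = Suc i\<close>] \<open>j = Suc i\<close>)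
    also have "\<dots> = (a i * a i) * (sign G (e i) * sign G (e i)) * \<tau> (v (Suc i))"
      unfolding aS by (simp only: ac_simps minus_mult_minus minus_mult_left[symmetric] minus_mult_right[symmetric] minus_minus)
    also have "\<dots> = \<tau> (v j)"
      by (simp only: unit_sq[OF au[OF less_imp_le[OF that(2)]]] unit_sq[OF sge[OF that(2)]] that(1) mult_1)
    finally show ?thesis .
  next
    \<comment> \<open>The last edge meets an initial half-edge, so the chain is closed and the
      latter belongs to \<open>e 0\<close>. The propagated value \<open>a n\<close> has to agree
      with the starting value \<open>a 0 = 1\<close>.\<close>
    case False
    then have n: "n = Suc i" using that by simp
    then have "v n = v 0" and P: "(\<Prod>i<n. - sign G (e i)) = (\<Prod>i<n. \<tau> (v i))"
      using bd that by auto
    then have "j = 0" using inj that n by auto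
    have "a n = (\<Prod>j<n. - sign G (e j)) * (\<Prod>j<n. \<tau> (v (Suc j)))"
      unfolding a_def by (rule prod.distrib)
    also have "\<dots> = (\<Prod>j<n. \<tau> (v j)) * (\<Prod>j<n. \<tau> (v j))"
      using P prod_shift_closed[of "\<lambda>i. \<tau> (v i)" n] \<open>v n = v 0\<close> by simp
    also have "\<dots> = (\<Prod>j<n. \<tau> (v j) * \<tau> (v j))" by (simp add: prod.distrib)
    also have "\<dots> = 1"
      using unit_sq[OF \<tau>] by simp
    finally have "a i * (- sign G (e i) * \<tau> (v j)) = 1" using n aS[of i] that by simp
    moreover have "a 0 = 1" by (simp add: a_def)
    moreover have "\<epsilon> (e i) (\<not> b i) * \<epsilon> (e j) (b j) = - sign G (e i) * a i * a 0"
      by (simp only: inn[OF that(2)] out[OF that(3), unfolded \<open>j = 0\<close>] \<open>j = 0\<close>)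
    moreover have "- sign G (e i) * a i = a i * (- sign G (e i) * \<tau> (v j)) * \<tau> (v j)"
      using unit_sq[OF \<tau>[of "v j"]] by (simp add: mult.assoc)
    ultimately show ?thesis by simp
  qed
  have edge: "(\<forall>c. \<epsilon> x c \<in> {1, -1}) \<and> \<epsilon> x False * \<epsilon> x True = - sign G x" if "x \<in> e ` {..<n}" for x
  proof -
    obtain i where i: "i < n" "x = e i" using \<open>x \<in> e ` {..<n}\<close> by auto
    have u: "a i \<in> {1, -1}" "sign G x \<in> {1, -1}" using au sge i by auto
    have "\<epsilon> x c = (if c = b i then a i else - sign G x * a i)" for c
      using i inj_e by (auto simp: \<epsilon>_def the_inv_into_f_f)
    then show ?thesis using u by (cases "b i") auto
  qed
  \<comment> \<open>Two initial half-edges at one vertex coincide, and so do two final ones; only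
    the pairs of a final and an initial half-edge, covered by \<open>join\<close>, remain.\<close>
  have vertex: "\<epsilon> x c * \<epsilon> y d = \<tau> (endpt G x c)"
    if xy: "x \<in> e ` {..<n}" "y \<in> e ` {..<n}" "(x, c) \<noteq> (y, d)" "endpt G x c = endpt G y d" for x y c d
  proof (rule chain_half_edge[OF ch xy(1,4)]; rule chain_half_edge[OF ch xy(2) refl])
    fix i j
    { assume "i < n" "x = e i" "c = b i" "endpt G y d = v i" "j < n" "y = e j" "d = b j" "endpt G y d = v j"
      then show "\<epsilon> x c * \<epsilon> y d = \<tau> (endpt G x c)" using inj[of i j] xy(3) by simp }
    { assume "i < n" "x = e i" "c = b i" "endpt G y d = v i"
        "j < n" "y = e j" "d = (\<not> b j)" "endpt G y d = v (Suc j)"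
      then show "\<epsilon> x c * \<epsilon> y d = \<tau> (endpt G x c)"
        using join[of j i] xy(4) by (simp add: mult.commute) }
    { assume "i < n" "x = e i" "c = (\<not> b i)" "endpt G y d = v (Suc i)"
        "j < n" "y = e j" "d = b j" "endpt G y d = v j"
      then show "\<epsilon> x c * \<epsilon> y d = \<tau> (endpt G x c)" using join[of i j] xy(4) by simp }
    { assume "i < n" "x = e i" "c = (\<not> b i)" "endpt G y d = v (Suc i)"
        "j < n" "y = e j" "d = (\<not> b j)" "endpt G y d = v (Suc j)"
      then show "\<epsilon> x c * \<epsilon> y d = \<tau> (endpt G x c)" using injS[of i j] xy(3) by simp }
  qed
  show ?thesis
    unfolding follows_def by (intro exI[of _ \<epsilon>] conjI ballI allI impI edge vertex)
qed

text \<open>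
  The product of all values of \<open>\<epsilon>\<close> on the cycle, computed once edge by edge and once vertex by vertex.
\<close>

lemma closed_chain_follows_prod:
  fixes \<tau> :: "'v \<Rightarrow> int"
  assumes ch: "edge_chain G n v e b" and n: "0 < n" and close: "v n = v 0"
    and f: "follows G (e ` {..<n}) \<tau> \<epsilon>"
  shows "(\<Prod>i<n. - sign G (e i)) = (\<Prod>i<n. \<tau> (v i))"
proof -
  \<comment> \<open>Wraps the index \<open>n\<close> to \<open>0\<close>, so that
    \<open>out n = out 0\<close> and the initial half-edges can be shifted cyclically to stand next
    to the final half-edges at the same vertex.\<close>
  define k where "k i = (if i = n then 0 else i)" for i
  define out where "out i = \<epsilon> (e (k i)) (b (k i))" for i
  have inj_e: "inj_on e {..<n}" using ch unfolding edge_chain_def by simp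
  have vk: "v (k i) = v i" for i using close by (simp add: k_def)
  have "(\<Prod>i<n. - sign G (e i)) = (\<Prod>i<n. \<epsilon> (e i) (\<not> b i) * out i)"
  proof (rule prod.cong)
    fix i assume i: "i \<in> {..<n}"
    then have "\<epsilon> (e i) False * \<epsilon> (e i) True = - sign G (e i)" using f unfolding follows_def by auto
    then show "- sign G (e i) = \<epsilon> (e i) (\<not> b i) * out i"
      using i by (cases "b i") (auto simp: out_def k_def mult.commute)
  qed simp
  also have "\<dots> = (\<Prod>i<n. \<epsilon> (e i) (\<not> b i)) * (\<Prod>i<n. out (Suc i))"
    using prod_shift_closed[of out n] by (simp add: prod.distrib out_def k_def)
  also have "\<dots> = (\<Prod>i<n. \<epsilon> (e i) (\<not> b i) * out (Suc i))" by (simp add: prod.distrib)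
  also have "\<dots> = (\<Prod>i<n. \<tau> (v (Suc i)))"
  proof (rule prod.cong)
    fix i assume i: "i \<in> {..<n}"
    have ks: "k (Suc i) < n" using i n by (auto simp: k_def)
    have "endpt G (e i) (\<not> b i) = v (Suc i)" "endpt G (e (k (Suc i))) (b (k (Suc i))) = v (Suc i)"
      using ch i ks vk[of "Suc i"] unfolding edge_chain_def by auto
    \<comment> \<open>If the edges agree then so do the indices, as for a single loop, and the two
      half-edges still differ in their end.\<close>
    moreover have "(e i, \<not> b i) \<noteq> (e (k (Suc i)), b (k (Suc i)))"
      using inj_onD[OF inj_e, of i "k (Suc i)"] i ks by auto
    ultimately show "\<epsilon> (e i) (\<not> b i) * out (Suc i) = \<tau> (v (Suc i))"
      using f i ks unfolding follows_def out_def by auto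
  qed simp
  also have "\<dots> = (\<Prod>i<n. \<tau> (v i))"
    using prod_shift_closed[of "\<lambda>i. \<tau> (v i)" n] close by simp
  finally show ?thesis .
qed

lemma closed_chain_vertices:
  assumes ch: "edge_chain G n v e b" and n: "0 < n" and close: "v n = v 0"
  shows "vertices_of G (e ` {..<n}) = v ` {..<n}"
proof -
  have en: "ends G (e i) = {v i, v (Suc i)}" if "i < n" for i
  proof -
    have "endpt G (e i) (b i) = v i" "endpt G (e i) (\<not> b i) = v (Suc i)"
      using ch that unfolding edge_chain_def by auto
    then show ?thesis unfolding ends_def UNIV_bool by (cases "b i") auto
  qed
  have "v (Suc i) \<in> v ` {..<n}" if "i < n" for i
    using that n close by (cases "Suc i = n") auto
  then show ?thesis unfolding vertices_of_def using en by auto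
qed

text \<open>The product of all arrows shows necessity and propagation once around the cycle shows
  sufficiency of the same identity, which is then rewritten as a parity.\<close>

lemma cycle_follows_iff:
  assumes cyc: "is_cycle G C" and sg: "\<And>x. x \<in> edges G \<Longrightarrow> sign G x \<in> {1, -1}"
  shows "(\<exists>\<epsilon>. follows G C (\<lambda>w. if w \<in> I then 1 else -1) \<epsilon>) \<longleftrightarrow>
    (balanced G C \<longleftrightarrow> even (card (vertices_of G C \<inter> I)))"
proof -
  let ?\<tau> = "\<lambda>w. if w \<in> I then 1 else -1 :: int"
  obtain n v e b where n: "0 < n" and ch: "edge_chain G n v e b" and close: "v n = v 0"
    and C: "C = e ` {..<n}"
    by (rule cycle_chain[OF cyc])
  have inj_e: "inj_on e {..<n}" and inj_v: "inj_on v {..<n}" using ch unfolding edge_chain_def by auto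
  define V where "V = vertices_of G C"
  have V: "V = v ` {..<n}" unfolding V_def C by (rule closed_chain_vertices[OF ch n close])
  then have fin: "finite V" and cV: "card V = n" using inj_v by (auto simp: card_image)
  have s: "(\<Prod>i<n. - sign G (e i)) = (-1) ^ n * (\<Prod>x\<in>C. sign G x)"
    unfolding C prod.reindex[OF inj_e] by (simp add: prod_uminus)
  have "(\<Prod>i<n. ?\<tau> (v i)) = (\<Prod>w\<in>V. ?\<tau> w)"
    unfolding V prod.reindex[OF inj_v] by simp
  also have "\<dots> = (-1) ^ card (V - I)"
    using fin by (simp add: prod.If_cases Diff_eq)
  finally have t: "(\<Prod>i<n. ?\<tau> (v i)) = (-1) ^ card (V - I)" .
  \<comment> \<open>Splitting the exponent of \<open>(-1) ^ n\<close> this way lets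
    \<open>(-1) ^ card (V - I)\<close> cancel against the vertex product.\<close>
  have "n = card (V \<inter> I) + card (V - I)"
    using cV fin by (metis card_Int_Diff)
  then have s': "(\<Prod>i<n. - sign G (e i)) =
      (-1) ^ card (V \<inter> I) * (-1) ^ card (V - I) * (\<Prod>x\<in>C. sign G x)"
    using s by (simp add: power_add)
  have "(\<Prod>x\<in>D. sign G x) \<in> {1, -1}" if "finite D" "D \<subseteq> edges G" for D
    using that
  proof (induction D rule: finite_induct)
    case (insert x D)
    then show ?case using sg[of x] by auto
  qed simp
  then have "(\<Prod>x\<in>C. sign G x) \<in> {1, -1}" using ch unfolding C edge_chain_def by (auto simp: subset_iff)
  then have "(\<Prod>i<n. - sign G (e i)) = (\<Prod>i<n. ?\<tau> (v i)) \<longleftrightarrow> (balanced G C \<longleftrightarrow> even (card (V \<inter> I)))"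
    unfolding s' t balanced_def
    by (cases "even (card (V \<inter> I))"; cases "even (card (V - I))") auto
  moreover have "(\<exists>\<epsilon>. follows G C ?\<tau> \<epsilon>) \<longleftrightarrow> (\<Prod>i<n. - sign G (e i)) = (\<Prod>i<n. ?\<tau> (v i))"
    using closed_chain_follows_prod[OF ch n close] chain_follows[OF ch sg, of ?\<tau>] close
    unfolding C by auto
  ultimately show ?thesis unfolding V_def by simp
qed

lemma cycle_half_edges_ge_2:
  assumes cyc: "is_cycle G C" and w: "w \<in> vertices_of G C"
  obtains x c y d where "x \<in> C" "y \<in> C" "(x, c) \<noteq> (y, d)" "endpt G x c = w" "endpt G y d = w"
proof -
  obtain n v e b where n: "0 < n" and ch: "edge_chain G n v e b" and close: "v n = v 0"
    and C: "C = e ` {..<n}"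
    by (rule cycle_chain[OF cyc])
  obtain i where i: "i < n" "w = v i" using w closed_chain_vertices[OF ch n close] C by auto
  define j where "j = (if i = 0 then n - 1 else i - 1)"
  have j: "j < n" "v (Suc j) = w" using i n close by (auto simp: j_def)
  have "endpt G (e i) (b i) = w" "endpt G (e j) (\<not> b j) = w" using ch i j unfolding edge_chain_def by auto
  moreover have "(e i, b i) \<noteq> (e j, \<not> b j)" using ch i j unfolding edge_chain_def inj_on_def by auto
  ultimately show ?thesis using that[of "e i" "e j" "b i" "\<not> b j"] i j C by auto
qed

section \<open>Connectedness\<close>

text \<open>The relation whose classes form \<open>components G V (edges G)\<close>. All edges are
  kept, so for \<open>V = verts G - {w}\<close> the edges at \<open>w\<close> survive and tell on
  which side of \<open>w\<close> they lie; this is why connectedness is mostly stated between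
  edges.\<close>

definition conn :: "('v, 'e) sgraph \<Rightarrow> 'v set \<Rightarrow> (('v + 'e) \<times> ('v + 'e)) set" where
  "conn G V = (incidence G V (edges G) \<union> (incidence G V (edges G))\<inverse>)\<^sup>*"

lemma conn_refl: "(x, x) \<in> conn G V" unfolding conn_def by simp

lemma conn_sym: "(x, y) \<in> conn G V \<Longrightarrow> (y, x) \<in> conn G V"
  unfolding conn_def by (rule symD[OF sym_rtrancl[OF sym_Un_converse]])

lemma conn_trans: "(x, y) \<in> conn G V \<Longrightarrow> (y, z) \<in> conn G V \<Longrightarrow> (x, z) \<in> conn G V"
  unfolding conn_def by (rule rtrancl_trans)

lemma equiv_conn: "equiv UNIV (conn G V)"
  by (intro equivI refl_onI symI transI conn_refl subset_UNIV) (auto intro: conn_sym conn_trans)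

lemma conn_edge:
  assumes "w \<in> V" "x \<in> edges G" "w \<in> ends G x"
  shows "(Inl w, Inr x) \<in> conn G V"
  using assms unfolding conn_def incidence_def by blast

lemma conn_adjacent:
  assumes "w \<in> V" "x \<in> edges G" "y \<in> edges G" "w \<in> ends G x" "w \<in> ends G y"
  shows "(Inr x, Inr y) \<in> conn G V"
  by (rule conn_trans[OF conn_sym[OF conn_edge] conn_edge]) (use assms in auto)

lemma connected_graph_conn:
  assumes "connected_graph G" "x \<in> verts G <+> edges G" "y \<in> verts G <+> edges G"
  shows "(x, y) \<in> conn G (verts G)"
proof -
  obtain X where X: "(verts G <+> edges G) // conn G (verts G) = {X}"
    using assms(1) unfolding connected_graph_def components_def conn_def by (auto simp: card_1_singleton_iff)
  have "conn G (verts G) `` {z} = X" if "z \<in> verts G <+> edges G" for z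
    using quotientI[OF that, of "conn G (verts G)"] unfolding X by simp
  then have "conn G (verts G) `` {x} = conn G (verts G) `` {y}" using assms(2,3) by simp
  then show ?thesis using eq_equiv_class[OF _ equiv_conn] by simp
qed

text \<open>In a connected graph, every component of the graph without \<open>v\<close> contains an edge at \<open>v\<close>.\<close>

lemma not_cut_point:
  assumes con: "connected_graph G" and v: "v \<in> ends G x" and x: "x \<in> edges G"
    and all: "\<And>y. y \<in> edges G \<Longrightarrow> v \<in> ends G y \<Longrightarrow> (Inr x, Inr y) \<in> conn G (verts G - {v})"
  shows "\<not> cut_point G v"
proof
  assume cut: "cut_point G v"
  let ?r = "conn G (verts G - {v})"
  \<comment> \<open>A connection through \<open>v\<close> leaves it along an edge at
    \<open>v\<close>, and by \<open>all\<close> such an edge is connected to \<open>x\<close>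
    without using \<open>v\<close>.\<close>
  have reach: "y = Inl v \<or> (Inr x, y) \<in> ?r" if "(Inr x, y) \<in> conn G (verts G)" for y
    using that unfolding conn_def[of G "verts G"]
  proof (induction rule: rtrancl_induct)
    case base then show ?case using conn_refl by simp
  next
    case (step y z)
    consider u e where "y = Inl u" "z = Inr e" "e \<in> edges G" "u \<in> verts G" "u \<in> ends G e"
      | u e where "y = Inr e" "z = Inl u" "e \<in> edges G" "u \<in> verts G" "u \<in> ends G e"
      using step.hyps(2) unfolding incidence_def by auto
    then show ?case
    proof cases
      case 1
      show ?thesis
      proof (cases "u = v")
        case True then show ?thesis using 1 all by simp
      next
        case False
        then show ?thesis using 1 step.IH conn_trans[OF _ conn_edge[of u "verts G - {v}" e]] by auto
      qed
    next
      case 2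
      then show ?thesis using step.IH conn_trans[OF _ conn_sym[OF conn_edge[of u "verts G - {v}" e]]] by auto
    qed
  qed
  have "components G (verts G - {v}) (edges G) \<subseteq> {?r `` {Inr x}}"
  proof
    fix X assume "X \<in> components G (verts G - {v}) (edges G)"
    then obtain y where y: "y \<in> (verts G - {v}) <+> edges G" "X = ?r `` {y}"
      unfolding components_def conn_def[symmetric] by (auto elim: quotientE)
    then have "(Inr x, y) \<in> conn G (verts G)" "y \<noteq> Inl v"
      using connected_graph_conn[OF con] x by auto
    then have "(Inr x, y) \<in> ?r" using reach by blast
    then show "X \<in> {?r `` {Inr x}}"
      using y(2) equiv_class_eq[OF equiv_conn] by fastforce
  qed
  then have "card (components G (verts G - {v}) (edges G)) \<le> 1"
    using card_mono[of "{?r `` {Inr x}}"] by fastforce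
  then show False using cut con unfolding cut_point_def connected_graph_def by simp
qed

text \<open>Removing one vertex opens a cycle into a path that still carries all its edges.\<close>

lemma cycle_conn:
  assumes cyc: "is_cycle G C" and G: "\<And>x. x \<in> edges G \<Longrightarrow> ends G x \<subseteq> verts G"
    and xy: "x \<in> C" "y \<in> C"
  shows "(Inr x, Inr y) \<in> conn G (verts G - {w})"
proof -
  obtain n v e b where n: "0 < n" and ch: "edge_chain G n v e b" and close: "v n = v 0"
    and C: "C = e ` {..<n}"
    by (rule cycle_chain[OF cyc])
  let ?r = "conn G (verts G - {w})"
  have inj: "i = j" if "v i = v j" "i < n" "j < n" for i j
    using ch that unfolding edge_chain_def inj_on_def by auto
  have e: "e i \<in> edges G" "v i \<in> ends G (e i)" "v (Suc i) \<in> ends G (e i)" "v i \<in> verts G" if "i < n" for i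
  proof -
    show *: "e i \<in> edges G" using ch that unfolding edge_chain_def by auto
    have "endpt G (e i) (b i) = v i" "endpt G (e i) (\<not> b i) = v (Suc i)"
      using ch that unfolding edge_chain_def by auto
    then show **: "v i \<in> ends G (e i)" "v (Suc i) \<in> ends G (e i)"
      unfolding ends_def by (metis rangeI)+
    show "v i \<in> verts G" using G[OF *] ** by auto
  qed
  have run: "(Inr (e i), Inr (e j)) \<in> ?r" if "i \<le> j" "j < n" "\<And>k. i < k \<Longrightarrow> k \<le> j \<Longrightarrow> v k \<noteq> w" for i j
    using that
  proof (induction j rule: dec_induct)
    case base show ?case by (rule conn_refl)
  next
    case (step j)
    then have "(Inr (e i), Inr (e j)) \<in> ?r" by auto
    moreover have "(Inr (e j), Inr (e (Suc j))) \<in> ?r"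
      using step e[of j] e[of "Suc j"] by (intro conn_adjacent[of "v (Suc j)"]) auto
    ultimately show ?case by (rule conn_trans)
  qed
  \<comment> \<open>If \<open>w\<close> lies on the cycle, \<open>k\<close> is its index: going once
    around from \<open>e k\<close> meets \<open>w\<close> at no junction of consecutive edges.
    Otherwise any start does, and \<open>0\<close> is taken.\<close>
  obtain k where k: "\<And>i. i < n \<Longrightarrow> (Inr (e k), Inr (e i)) \<in> ?r"
  proof (cases "\<exists>k<n. v k = w")
    case False
    then have "(Inr (e 0), Inr (e i)) \<in> ?r" if "i < n" for i using run[of 0 i] that by auto
    then show ?thesis by (rule that)
  next
    case True
    then obtain k where k: "k < n" "v k = w" by blast
    have ne: "v i \<noteq> w" if "i < n" "i \<noteq> k" for i using k that inj by blast
    have up: "(Inr (e k), Inr (e i)) \<in> ?r" if "i < n" "k \<le> i" for i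
      using that ne by (intro run) auto
    have "(Inr (e k), Inr (e i)) \<in> ?r" if "i < n" "i < k" for i
    proof -
      have "(Inr (e 0), Inr (e i)) \<in> ?r" using that k ne by (intro run) auto
      moreover have "(Inr (e (n - 1)), Inr (e 0)) \<in> ?r"
        using e[of 0] e[of "n - 1"] n close that ne[of 0] by (intro conn_adjacent[of "v 0"]) auto
      moreover have "(Inr (e k), Inr (e (n - 1))) \<in> ?r" using up k by auto
      ultimately show ?thesis by (meson conn_trans)
    qed
    then show ?thesis using up by (meson that linorder_not_less)
  qed
  obtain i j where "x = e i" "i < n" "y = e j" "j < n" using xy C by auto
  then show ?thesis using conn_trans[OF conn_sym[OF k] k] by simp
qed

section \<open>Block paths\<close>

lemma path_end_half_edge_unique:
  assumes p: "simple_path G vs es" and w: "w = hd vs \<or> w = last vs"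
    and x: "x \<in> set es" "endpt G x c = w" and y: "y \<in> set es" "endpt G y d = w"
  shows "(x, c) = (y, d)"
proof -
  obtain b where ch: "edge_chain G (length es) ((!) vs) ((!) es) b" and inj: "inj_on ((!) vs) {..length es}"
    using path_chain[OF p] .
  define n where "n = length es"
  have "length vs = Suc n" using p unfolding simple_path_def walk_def n_def by simp
  then have ends: "w = vs ! 0 \<or> w = vs ! n"
    using w by (metis hd_conv_nth last_conv_nth length_0_conv nat.distinct(1) diff_Suc_1)
  have inj: "i = j" if "vs ! i = vs ! j" "i \<le> n" "j \<le> n" for i j
    using inj_onD[OF inj that(1)] that(2,3) by (simp add: n_def)
  have es: "set es = (!) es ` {..<length es}" by (auto simp: set_conv_nth)
  have ch: "edge_chain G n ((!) vs) ((!) es) b" using ch by (simp add: n_def)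
  \<comment> \<open>The only possible half-edge at an end of the path: the initial one of the first
    edge or the final one of the last edge. For a path without edges the value of \<open>h\<close>
    is arbitrary and nothing has to be shown.\<close>
  define h where "h = (if w = vs ! 0 then (es ! 0, b 0) else (es ! (n - 1), \<not> b (n - 1)))"
  have "(z, k) = h" if z: "z \<in> set es" "endpt G z k = w" for z k
  proof (rule chain_half_edge[OF ch z(1)[unfolded es n_def[symmetric]] z(2)])
    fix i assume i: "i < n" "z = es ! i" "k = b i" "w = vs ! i"
    then have "i = 0" using ends inj[of i 0] inj[of i n] by auto
    then show ?thesis using i by (simp add: h_def)
  next
    fix i assume i: "i < n" "z = es ! i" "k = (\<not> b i)" "w = vs ! Suc i"
    then have "Suc i = n" using ends inj[of "Suc i" 0] inj[of "Suc i" n] by auto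
    moreover have "w \<noteq> vs ! 0" using i inj[of "Suc i" 0] by auto
    ultimately show ?thesis using i by (auto simp: h_def)
  qed
  then show ?thesis using x y by metis
qed

lemma path_half_edges:
  assumes p: "simple_path G vs es" and w: "w \<in> set vs"
  shows "es \<noteq> [] \<Longrightarrow> \<exists>x\<in>set es. \<exists>c. endpt G x c = w"
    and "w \<noteq> hd vs \<Longrightarrow> w \<noteq> last vs \<Longrightarrow>
      \<exists>x\<in>set es. \<exists>y\<in>set es. \<exists>c d. (x, c) \<noteq> (y, d) \<and> endpt G x c = w \<and> endpt G y d = w"
proof -
  obtain b where ch: "edge_chain G (length es) ((!) vs) ((!) es) b"
    using path_chain[OF p] .
  define n where "n = length es"
  have len: "length vs = Suc n" using p unfolding simple_path_def walk_def n_def by simp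
  obtain i where "i < length vs" "vs ! i = w" using w unfolding in_set_conv_nth by blast
  then have i: "i \<le> n" "w = vs ! i" using len by auto
  have b: "endpt G (es ! i) (b i) = vs ! i" "endpt G (es ! i) (\<not> b i) = vs ! Suc i"
    "es ! i \<in> set es" if "i < n" for i
    using ch that unfolding edge_chain_def n_def by auto
  show "\<exists>x\<in>set es. \<exists>c. endpt G x c = w" if "es \<noteq> []"
  proof (cases "i < n")
    case True then show ?thesis using b(1,3) i(2) by blast
  next
    case False
    then have "n - 1 < n" "Suc (n - 1) = i" using i that by (auto simp: n_def)
    then show ?thesis using b(2,3)[of "n - 1"] i(2) by metis
  qed
  show "\<exists>x\<in>set es. \<exists>y\<in>set es. \<exists>c d. (x, c) \<noteq> (y, d) \<and> endpt G x c = w \<and> endpt G y d = w"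
    if "w \<noteq> hd vs" "w \<noteq> last vs"
  proof -
    have "w \<noteq> vs ! 0" "w \<noteq> vs ! n"
      using that len by (metis hd_conv_nth last_conv_nth length_0_conv nat.distinct(1) diff_Suc_1)+
    then have "i \<noteq> 0" "i \<noteq> n" unfolding i(2) by metis+
    then obtain j where j: "i = Suc j" "j < n" "i < n" using i(1) by (cases i) auto
    have "inj_on ((!) es) {..<n}" using ch unfolding edge_chain_def n_def by simp
    then have "es ! j \<noteq> es ! i" using inj_onD[of "(!) es" "{..<n}" j i] j by auto
    then have "(es ! j, \<not> b j) \<noteq> (es ! i, b i)" by simp
    moreover have "endpt G (es ! j) (\<not> b j) = w" "endpt G (es ! i) (b i) = w"
      using b(2)[of j] b(1)[of i] j i(2) by simp_all
    moreover have "es ! j \<in> set es" "es ! i \<in> set es" using b(3) j by auto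
    ultimately show ?thesis
      by (intro bexI[of _ "es ! j"] bexI[of _ "es ! i"] exI[of _ "\<not> b j"] exI[of _ "b i"] conjI)
  qed
qed

lemma path_edge_vertex:
  assumes p: "simple_path G vs es" and x: "x \<in> set es"
  shows "endpt G x c \<in> set vs"
proof -
  obtain b where ch: "edge_chain G (length es) ((!) vs) ((!) es) b"
    using path_chain[OF p] .
  have len: "length vs = Suc (length es)" using p unfolding simple_path_def walk_def by simp
  have x: "x \<in> (!) es ` {..<length es}" using x by (auto simp: set_conv_nth)
  show ?thesis
  proof (rule chain_half_edge[OF ch x refl])
    fix i assume "i < length es" "endpt G x c = vs ! i"
    then show ?thesis using nth_mem[of i vs] len by simp
  next
    fix i assume "i < length es" "endpt G x c = vs ! Suc i"
    then show ?thesis using nth_mem[of "Suc i" vs] len by simp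
  qed
qed

lemma in_ends_iff: "w \<in> ends G x \<longleftrightarrow> (\<exists>c. endpt G x c = w)"
  unfolding ends_def by blast

section \<open>Blocks of a cycle-tree\<close>

locale block_tree =
  fixes T :: "('v, 'e) sgraph" and Cs :: "'e set set" and Ps :: "('v list \<times> 'e list) set"
  assumes T: "signed_graph T" and ct: "cycle_tree T Cs Ps"
begin

definition I where "I = intersection_vertices T Cs Ps"

text \<open>At an intersection vertex a block cycle must have a sink or a source, hence equal
  arrows; elsewhere one block supplies all half-edges, and its arrows must differ to avoid a sink or
  source.\<close>

definition \<tau> :: "'v \<Rightarrow> int" where "\<tau> w = (if w \<in> I then 1 else -1)"

text \<open>Without the paths of length zero, the blocks are nonempty and partition the edges. At
  such a path the two blocks that meet are the two cycles themselves.\<close>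

definition Bs where "Bs = Cs \<union> {set es | vs es. (vs, es) \<in> Ps \<and> es \<noteq> []}"

lemma ends_verts: "x \<in> edges T \<Longrightarrow> ends T x \<subseteq> verts T"
  and sign_unit: "x \<in> edges T \<Longrightarrow> sign T x \<in> {1, -1}"
  and finite_verts: "finite (verts T)"
  using T unfolding signed_graph_def by auto

lemma connected: "connected_graph T"
  using ct unfolding cycle_tree_def by (elim conjE)

lemma path_simple: "(vs, es) \<in> Ps \<Longrightarrow> simple_path T vs es"
  using ct unfolding cycle_tree_def by (elim conjE) (drule bspec, assumption, simp)

lemma path_unique:
  assumes "(vs, es) \<in> Ps" "(vs', es') \<in> Ps" "w \<in> set vs" "w \<in> set vs'"
  shows "(vs, es) = (vs', es')"
proof -
  have "\<forall>(vs, es)\<in>Ps. \<forall>(vs', es')\<in>Ps. (vs, es) \<noteq> (vs', es') \<longrightarrow> set vs \<inter> set vs' = {}"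
    using ct unfolding cycle_tree_def by (elim conjE)
  then show ?thesis using assms by fast
qed

lemma cycle_path_disjoint: "C \<in> Cs \<Longrightarrow> (vs, es) \<in> Ps \<Longrightarrow> x \<in> C \<Longrightarrow> x \<notin> set es"
proof -
  have "\<forall>C\<in>Cs. \<forall>(vs, es)\<in>Ps. C \<inter> set es = {}"
    using ct unfolding cycle_tree_def by (elim conjE)
  then show "C \<in> Cs \<Longrightarrow> (vs, es) \<in> Ps \<Longrightarrow> x \<in> C \<Longrightarrow> x \<notin> set es" by fast
qed

lemma cycles_unique: "C \<in> Cs \<Longrightarrow> D \<in> Cs \<Longrightarrow> x \<in> C \<Longrightarrow> x \<in> D \<Longrightarrow> C = D"
proof -
  have "pairwise disjnt Cs" using ct unfolding cycle_tree_def by (elim conjE)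
  then show "C \<in> Cs \<Longrightarrow> D \<in> Cs \<Longrightarrow> x \<in> C \<Longrightarrow> x \<in> D \<Longrightarrow> C = D"
    unfolding pairwise_def disjnt_def by fast
qed

lemma cycle: "C \<in> Cs \<Longrightarrow> is_cycle T C"
proof -
  have "Cs = {C. is_cycle T C}" using ct unfolding cycle_tree_def by (elim conjE)
  then show "C \<in> Cs \<Longrightarrow> is_cycle T C" by fast
qed

lemma edges_eq: "edges T = \<Union>Cs \<union> (\<Union>(vs, es)\<in>Ps. set es)"
  using ct unfolding cycle_tree_def by (elim conjE)

lemma verts_eq: "verts T = (\<Union>C\<in>Cs. vertices_of T C) \<union> (\<Union>(vs, es)\<in>Ps. set vs)"
  using ct unfolding cycle_tree_def by (elim conjE)

lemma cycles_meet:
  assumes "C \<in> Cs" "D \<in> Cs" "C \<noteq> D" "w \<in> vertices_of T C" "w \<in> vertices_of T D"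
  shows "([w], []) \<in> Ps"
proof -
  have "\<forall>C\<in>Cs. \<forall>D\<in>Cs. C \<noteq> D \<longrightarrow>
        vertices_of T C \<inter> vertices_of T D = {} \<or>
        (\<exists>v. vertices_of T C \<inter> vertices_of T D = {v} \<and> ([v], []) \<in> Ps)"
    using ct unfolding cycle_tree_def by (elim conjE)
  then have "vertices_of T C \<inter> vertices_of T D = {} \<or>
        (\<exists>v. vertices_of T C \<inter> vertices_of T D = {v} \<and> ([v], []) \<in> Ps)"
    using assms(1-3) by simp
  then obtain v where v: "vertices_of T C \<inter> vertices_of T D = {v}" "([v], []) \<in> Ps"
    using assms(4,5) by blast
  have "w \<in> {v}" unfolding v(1)[symmetric] using assms(4,5) by simp
  then show ?thesis using v(2) by simp
qed

lemma path_meet: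
  assumes "(vs, es) \<in> Ps"
  obtains C D where "C \<in> Cs" "D \<in> Cs" "C \<noteq> D" "vertices_of T C \<inter> set vs = {hd vs}"
    "vertices_of T D \<inter> set vs = {last vs}"
    "\<forall>B\<in>Cs - {C, D}. vertices_of T B \<inter> set vs = {}"
proof -
  have "\<forall>(vs, es)\<in>Ps. \<exists>C\<in>Cs. \<exists>D\<in>Cs. C \<noteq> D \<and>
        vertices_of T C \<inter> set vs = {hd vs} \<and> vertices_of T D \<inter> set vs = {last vs} \<and>
        (\<forall>B\<in>Cs - {C, D}. vertices_of T B \<inter> set vs = {})"
    using ct unfolding cycle_tree_def by (elim conjE)
  from bspec[OF this assms] show ?thesis
    unfolding prod.case by (elim bexE conjE) (rule that)
qed

lemma int_cut: "w \<in> I \<Longrightarrow> cut_point T w"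
proof -
  have "\<forall>v\<in>intersection_vertices T Cs Ps. cut_point T v"
    using ct unfolding cycle_tree_def by (elim conjE)
  then show "w \<in> I \<Longrightarrow> cut_point T w" by (simp add: I_def)
qed

lemma path_nonempty: "(vs, es) \<in> Ps \<Longrightarrow> vs \<noteq> []"
  using path_simple unfolding simple_path_def walk_def by fastforce

text \<open>Both kinds of intersection vertices reduce to one: a common vertex of two block cycles
  is itself a block path of length zero.\<close>

lemma int_path:
  assumes "w \<in> I"
  obtains vs es where "(vs, es) \<in> Ps" "w = hd vs \<or> w = last vs" "w \<in> set vs"
proof -
  consider C D where "C \<in> Cs" "D \<in> Cs" "C \<noteq> D" "w \<in> vertices_of T C" "w \<in> vertices_of T D"
    | vs es where "(vs, es) \<in> Ps" "w = hd vs \<or> w = last vs"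
    using assms unfolding I_def intersection_vertices_def by auto
  then show ?thesis
  proof cases
    case 1 then show ?thesis using that[of "[w]" "[]"] cycles_meet by simp
  next
    case 2 then show ?thesis using that path_nonempty[of vs es] by auto
  qed
qed

lemma path_end_int: "(vs, es) \<in> Ps \<Longrightarrow> w = hd vs \<or> w = last vs \<Longrightarrow> w \<in> I"
  unfolding I_def intersection_vertices_def by blast

lemma path_cycle_int:
  assumes p: "(vs, es) \<in> Ps" and "w \<in> set vs" "C \<in> Cs" "w \<in> vertices_of T C"
  shows "w = hd vs \<or> w = last vs"
  by (rule path_meet[OF p]) (use assms in blast)

lemma cycle_vertex: "x \<in> C \<Longrightarrow> endpt T x c \<in> vertices_of T C"
  unfolding vertices_of_def ends_def by blast

lemma edge_cases:
  assumes "x \<in> edges T"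
  obtains C where "C \<in> Cs" "x \<in> C" | vs es where "(vs, es) \<in> Ps" "x \<in> set es"
  using assms unfolding edges_eq by auto

lemma block_cases:
  assumes "B \<in> Bs"
  obtains "B \<in> Cs" | vs es where "(vs, es) \<in> Ps" "es \<noteq> []" "B = set es"
  using assms unfolding Bs_def by auto

lemma cycle_block: "C \<in> Cs \<Longrightarrow> C \<in> Bs"
  unfolding Bs_def by simp

lemma path_block: "(vs, es) \<in> Ps \<Longrightarrow> es \<noteq> [] \<Longrightarrow> set es \<in> Bs"
  unfolding Bs_def by blast

lemma block_edges: "B \<in> Bs \<Longrightarrow> x \<in> B \<Longrightarrow> x \<in> edges T"
  unfolding Bs_def edges_eq by auto

lemma edge_block:
  assumes "x \<in> edges T"
  obtains B where "B \<in> Bs" "x \<in> B"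
  using assms
proof (rule edge_cases)
  fix C assume "C \<in> Cs" "x \<in> C"
  then show ?thesis by (rule that[OF cycle_block])
next
  fix vs es assume p: "(vs, es) \<in> Ps" "x \<in> set es"
  then have "es \<noteq> []" by auto
  show ?thesis by (rule that[OF path_block[OF p(1) \<open>es \<noteq> []\<close>] p(2)])
qed

lemma block_unique:
  assumes "A \<in> Bs" "B \<in> Bs" "x \<in> A" "x \<in> B"
  shows "A = B"
  using assms(1)
proof (rule block_cases)
  assume A: "A \<in> Cs"
  show ?thesis using assms(2)
    by (rule block_cases) (use A assms cycles_unique cycle_path_disjoint in auto)
next
  fix vs es assume p: "(vs, es) \<in> Ps" "A = set es"
  show ?thesis using assms(2)
  proof (rule block_cases)
    assume "B \<in> Cs" then show ?thesis using p assms cycle_path_disjoint by auto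
  next
    fix vs' es' assume q: "(vs', es') \<in> Ps" "B = set es'"
    have "endpt T x True \<in> set vs" "endpt T x True \<in> set vs'"
      using path_edge_vertex[OF path_simple[OF p(1)]] path_edge_vertex[OF path_simple[OF q(1)]]
        p(2) q(2) assms(3,4) by simp_all
    then show ?thesis using path_unique[OF p(1) q(1)] p(2) q(2) by simp
  qed
qed

lemma block_chain:
  assumes "B \<in> Bs"
  obtains n v e b where "edge_chain T n v e b" "B = e ` {..<n}"
  using assms
proof (rule block_cases)
  assume "B \<in> Cs"
  then show ?thesis by (rule cycle_chain[OF cycle]) (rule that)
next
  fix vs es assume p: "(vs, es) \<in> Ps" "B = set es"
  obtain b where ch: "edge_chain T (length es) ((!) vs) ((!) es) b"
    using path_chain[OF path_simple[OF p(1)]] .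
  show ?thesis by (rule that[OF ch]) (auto simp: p(2) set_conv_nth)
qed

lemma block_half_edges_le_2:
  assumes "B \<in> Bs" "x \<in> B" "y \<in> B" "z \<in> B" "endpt T x bx = w" "endpt T y by' = w" "endpt T z bz = w"
  shows "(x, bx) = (y, by') \<or> (x, bx) = (z, bz) \<or> (y, by') = (z, bz)"
proof -
  obtain n v e b where ch: "edge_chain T n v e b" and B: "B = e ` {..<n}"
    by (rule block_chain[OF assms(1)])
  show ?thesis
    using chain_half_edges_le_2[OF ch _ _ _ assms(5-7)] assms(2-4) B by simp
qed

text \<open>Since block paths are vertex-disjoint, the path that ends at \<open>w\<close> is the
  given one, so \<open>w\<close> is no inner vertex of it. Hence the rule of equal arrows at
  intersection vertices is empty on block paths.\<close>

lemma path_int_half_edge_unique: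
  assumes p: "(vs, es) \<in> Ps" and w: "w \<in> I"
    and x: "x \<in> set es" "endpt T x c = w" and y: "y \<in> set es" "endpt T y d = w"
  shows "(x, c) = (y, d)"
proof -
  obtain vs' es' where q: "(vs', es') \<in> Ps" "w = hd vs' \<or> w = last vs'" "w \<in> set vs'"
    by (rule int_path[OF w])
  have "w \<in> set vs" using path_edge_vertex[OF path_simple[OF p] x(1)] x(2) by blast
  then have "vs = vs'" using path_unique[OF p q(1) _ q(3)] by simp
  then show ?thesis using path_end_half_edge_unique[OF path_simple[OF p] _ x y] q(2) by simp
qed

text \<open>A second cycle at \<open>w\<close>, or a path meeting a cycle there, would make
  \<open>w\<close> an intersection vertex. What remains is a single cycle, or a single path with
  \<open>w\<close> in its interior. With the upper bound for chains, exactly two half-edges lie at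
  \<open>w\<close>.\<close>

lemma vertex_not_int:
  assumes w: "w \<in> verts T" "w \<notin> I"
  obtains B x c y d where "B \<in> Bs" "\<And>z. z \<in> edges T \<Longrightarrow> w \<in> ends T z \<Longrightarrow> z \<in> B"
    "x \<in> B" "y \<in> B" "(x, c) \<noteq> (y, d)" "endpt T x c = w" "endpt T y d = w"
proof -
  consider C where "C \<in> Cs" "w \<in> vertices_of T C"
    | vs es where "(vs, es) \<in> Ps" "w \<in> set vs" "\<And>C. C \<in> Cs \<Longrightarrow> w \<notin> vertices_of T C"
    using w unfolding verts_eq by blast
  then show ?thesis
  proof cases
    case 1
    have all: "z \<in> C" if z: "z \<in> edges T" "w \<in> ends T z" for z
      using z(1)
    proof (rule edge_cases)
      fix D assume D: "D \<in> Cs" "z \<in> D"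
      then have "w \<in> vertices_of T D" using z(2) unfolding vertices_of_def by blast
      then have "D = C" using cycles_meet[OF 1(1) D(1) _ 1(2)] path_end_int[of "[w]" "[]" w] w(2) by auto
      then show ?thesis using D by simp
    next
      fix vs es assume p: "(vs, es) \<in> Ps" "z \<in> set es"
      then have "w \<in> set vs" using z(2) path_edge_vertex[OF path_simple] unfolding in_ends_iff by blast
      then show ?thesis using path_cycle_int[OF p(1) _ 1] path_end_int[OF p(1)] w(2) by blast
    qed
    show ?thesis
      by (rule cycle_half_edges_ge_2[OF cycle[OF 1(1)] 1(2)])
        (rule that[OF cycle_block[OF 1(1)] all], assumption+)
  next
    case 2
    have inner: "w \<noteq> hd vs" "w \<noteq> last vs" using path_end_int[OF 2(1)] w(2) by auto
    obtain x y c d where xy: "x \<in> set es" "y \<in> set es" "(x, c) \<noteq> (y, d)" "endpt T x c = w" "endpt T y d = w"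
      using path_half_edges(2)[OF path_simple[OF 2(1)] 2(2) inner] by (elim bexE exE conjE)
    have all: "z \<in> set es" if z: "z \<in> edges T" "w \<in> ends T z" for z
      using z(1)
    proof (rule edge_cases)
      fix D assume D: "D \<in> Cs" "z \<in> D"
      then have "w \<in> vertices_of T D" using z(2) unfolding vertices_of_def by blast
      then show ?thesis using 2(3) D by simp
    next
      fix vs' es' assume p: "(vs', es') \<in> Ps" "z \<in> set es'"
      then have "w \<in> set vs'" using z(2) path_edge_vertex[OF path_simple] unfolding in_ends_iff by blast
      then show ?thesis using path_unique[OF 2(1) p(1) 2(2)] p(2) by simp
    qed
    have "es \<noteq> []" using xy(1) by auto
    then have "set es \<in> Bs" by (rule path_block[OF 2(1)])
    then show ?thesis by (rule that[OF _ all xy])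
  qed
qed

text \<open>The block path ending at \<open>w\<close> decides which blocks meet: for length zero
  they are the two cycles it joins, otherwise the path itself and the cycle at that end.\<close>

lemma vertex_int:
  assumes w: "w \<in> I"
  obtains A B x y where "A \<in> Bs" "B \<in> Bs" "A \<noteq> B" "x \<in> A" "y \<in> B" "w \<in> ends T x" "w \<in> ends T y"
    "\<And>z. z \<in> edges T \<Longrightarrow> w \<in> ends T z \<Longrightarrow> z \<in> A \<or> z \<in> B"
proof -
  obtain vs es where p: "(vs, es) \<in> Ps" "w = hd vs \<or> w = last vs" "w \<in> set vs"
    by (rule int_path[OF w])
  obtain C D where CD: "C \<in> Cs" "D \<in> Cs" "C \<noteq> D" "vertices_of T C \<inter> set vs = {hd vs}"
    "vertices_of T D \<inter> set vs = {last vs}"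
    "\<forall>B\<in>Cs - {C, D}. vertices_of T B \<inter> set vs = {}"
    by (rule path_meet[OF p(1)])
  have cyc: "A = C \<and> w = hd vs \<or> A = D \<and> w = last vs" if "A \<in> Cs" "w \<in> vertices_of T A" for A
    using CD(4-6) that p(3) by blast
  have path: "es' = es" if q: "(vs', es') \<in> Ps" "z \<in> set es'" "w \<in> ends T z" for vs' es' z
  proof -
    have "w \<in> set vs'" using q path_edge_vertex[OF path_simple] unfolding in_ends_iff by blast
    then show ?thesis using path_unique[OF p(1) q(1) p(3)] by simp
  qed
  have len: "length vs = Suc (length es)" "distinct vs"
    using path_simple[OF p(1)] unfolding simple_path_def walk_def by auto
  show ?thesis
  proof (cases "es = []")
    case True
    then have "w = hd vs" "w = last vs" using len p(2) by (cases vs; simp)+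
    then have V: "w \<in> vertices_of T C" "w \<in> vertices_of T D" using CD(4,5) by blast+
    obtain x where x: "x \<in> C" "w \<in> ends T x" using V(1) unfolding vertices_of_def by blast
    obtain y where y: "y \<in> D" "w \<in> ends T y" using V(2) unfolding vertices_of_def by blast
    have "z \<in> C \<or> z \<in> D" if z: "z \<in> edges T" "w \<in> ends T z" for z
      using z(1)
    proof (rule edge_cases)
      fix A assume A: "A \<in> Cs" "z \<in> A"
      then have "w \<in> vertices_of T A" using z(2) unfolding vertices_of_def by blast
      then show ?thesis using cyc[OF A(1)] A(2) by auto
    next
      fix vs' es' assume "(vs', es') \<in> Ps" "z \<in> set es'"
      then show ?thesis using path[of vs' es' z] z True by simp
    qed
    then show ?thesis by (rule that[OF cycle_block[OF CD(1)] cycle_block[OF CD(2)] CD(3) x(1) y(1) x(2) y(2)])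
  next
    case False
    \<comment> \<open>For a path of positive length the two cycles touch it at different ends, so
      only one of them contains \<open>w\<close>.\<close>
    then have "hd vs \<noteq> last vs" using len by (cases vs; cases es) auto
    obtain A where A: "A \<in> Cs" "w \<in> vertices_of T A" "\<And>B. B \<in> Cs \<Longrightarrow> w \<in> vertices_of T B \<Longrightarrow> B = A"
    proof (cases "w = hd vs")
      case True
      then have V: "w \<in> vertices_of T C" using CD(4) by blast
      have "B = C" if "B \<in> Cs" "w \<in> vertices_of T B" for B
        using cyc[OF that] True \<open>hd vs \<noteq> last vs\<close> by simp
      then show ?thesis by (rule that[OF CD(1) V])
    next
      case F: False
      then have V: "w \<in> vertices_of T D" using CD(5) p(2) by blast
      have "B = D" if "B \<in> Cs" "w \<in> vertices_of T B" for B
        using cyc[OF that] F by simp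
      then show ?thesis by (rule that[OF CD(2) V])
    qed
    obtain x where x: "x \<in> A" "w \<in> ends T x" using A(2) unfolding vertices_of_def by blast
    obtain y c where "y \<in> set es" "endpt T y c = w"
      using path_half_edges(1)[OF path_simple[OF p(1)] p(3) False] by (elim bexE exE)
    then have y: "y \<in> set es" "w \<in> ends T y" unfolding in_ends_iff by auto
    have "z \<in> A \<or> z \<in> set es" if z: "z \<in> edges T" "w \<in> ends T z" for z
      using z(1)
    proof (rule edge_cases)
      fix B assume B: "B \<in> Cs" "z \<in> B"
      then have "w \<in> vertices_of T B" using z(2) unfolding vertices_of_def by blast
      then show ?thesis using A(3)[OF B(1)] B(2) by auto
    next
      fix vs' es' assume "(vs', es') \<in> Ps" "z \<in> set es'"
      then show ?thesis using path[of vs' es' z] z by simp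
    qed
    moreover have "A \<noteq> set es" using x(1) cycle_path_disjoint[OF A(1) p(1)] by blast
    ultimately show ?thesis
      using that[OF cycle_block[OF A(1)] path_block[OF p(1) False] _ x(1) y(1) x(2) y(2)] by blast
  qed
qed

section \<open>Blocks at a common vertex, and the sides of a cut-point\<close>

lemma blocks_meet_int:
  assumes "A \<in> Bs" "B \<in> Bs" "A \<noteq> B" "x \<in> A" "y \<in> B" "w \<in> ends T x" "w \<in> ends T y"
  shows "w \<in> I"
proof (rule ccontr)
  assume w: "w \<notin> I"
  have xy: "x \<in> edges T" "y \<in> edges T" using assms block_edges by auto
  then have "w \<in> verts T" using ends_verts assms(6) by blast
  then obtain D where D: "D \<in> Bs" "\<And>z. z \<in> edges T \<Longrightarrow> w \<in> ends T z \<Longrightarrow> z \<in> D"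
    by (rule vertex_not_int[OF _ w]) (rule that)
  then have "A = D" "B = D" using block_unique assms xy by auto
  then show False using assms(3) by simp
qed

lemma blocks_at_vertex_le_2:
  assumes "A \<in> Bs" "B \<in> Bs" "A \<noteq> B" "x \<in> A" "y \<in> B" "w \<in> ends T x" "w \<in> ends T y"
    and "D \<in> Bs" "z \<in> D" "w \<in> ends T z"
  shows "D = A \<or> D = B"
proof -
  have E: "x \<in> edges T" "y \<in> edges T" "z \<in> edges T" using assms block_edges by auto
  obtain A' B' where AB: "A' \<in> Bs" "B' \<in> Bs" "\<And>z. z \<in> edges T \<Longrightarrow> w \<in> ends T z \<Longrightarrow> z \<in> A' \<or> z \<in> B'"
    by (rule vertex_int[OF blocks_meet_int[OF assms(1-7)]]) (rule that)
  have "A = A' \<or> A = B'" "B = A' \<or> B = B'" "D = A' \<or> D = B'"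
    using AB(3)[OF E(1)] AB(3)[OF E(2)] AB(3)[OF E(3)] assms AB(1,2) block_unique by auto
  then show ?thesis using assms(3) by auto
qed

text \<open>Removing \<open>w\<close> does not tear a block apart at a common vertex of two of its
  edges: a vertex other than \<open>w\<close> still joins them, a cycle can be followed the other
  way around, and a path has only one edge at the intersection vertex \<open>w\<close>.\<close>

lemma block_conn:
  assumes w: "w \<in> I" and B: "B \<in> Bs" and x: "x \<in> B" "u \<in> ends T x" and y: "y \<in> B" "u \<in> ends T y"
  shows "(Inr x, Inr y) \<in> conn T (verts T - {w})"
proof (cases "u = w")
  case False
  have "x \<in> edges T" "y \<in> edges T" using block_edges B x y by auto
  moreover from this have "u \<in> verts T - {w}" using False ends_verts x by blast
  ultimately show ?thesis using conn_adjacent x y by metis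
next
  case True
  show ?thesis using B
  proof (rule block_cases)
    assume "B \<in> Cs"
    then show ?thesis using cycle_conn[OF cycle ends_verts x(1) y(1)] by simp
  next
    fix vs es assume p: "(vs, es) \<in> Ps" "B = set es"
    obtain c d where "endpt T x c = w" "endpt T y d = w" using x y True unfolding in_ends_iff by blast
    then have "x = y" using path_int_half_edge_unique[OF p(1) w, of x c y d] x y p by simp
    then show ?thesis using conn_refl by simp
  qed
qed

text \<open>Only two blocks meet at \<open>w\<close>, and by \<open>block_conn\<close> the edges of
  each at \<open>w\<close> stay together. If the two were joined away from \<open>w\<close>, all
  edges at \<open>w\<close> would be, and \<open>w\<close> could not be a cut-point.\<close>

lemma blocks_not_conn:
  assumes A: "A \<in> Bs" "x \<in> A" "w \<in> ends T x" and B: "B \<in> Bs" "y \<in> B" "w \<in> ends T y" and "A \<noteq> B"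
  shows "(Inr x, Inr y) \<notin> conn T (verts T - {w})"
proof
  assume c: "(Inr x, Inr y) \<in> conn T (verts T - {w})"
  have w: "w \<in> I" using blocks_meet_int[OF A(1) B(1) assms(7) A(2) B(2) A(3) B(3)] .
  have "(Inr x, Inr z) \<in> conn T (verts T - {w})" if z: "z \<in> edges T" "w \<in> ends T z" for z
    using z(1)
  proof (rule edge_block)
    fix D assume D: "D \<in> Bs" "z \<in> D"
    then consider "D = A" | "D = B"
      using blocks_at_vertex_le_2[OF A(1) B(1) assms(7) A(2) B(2) A(3) B(3) D z(2)] by blast
    then show ?thesis
    proof cases
      case 1 then show ?thesis using block_conn[OF w A _ z(2)] D by simp
    next
      case 2
      then have "(Inr y, Inr z) \<in> conn T (verts T - {w})" using block_conn[OF w B _ z(2)] D by simp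
      then show ?thesis using c conn_trans by metis
    qed
  qed
  then show False
    using not_cut_point[OF connected A(3) block_edges[OF A(1,2)]] int_cut[OF w] by simp
qed

text \<open>Converse of \<open>int_cut\<close> on block cycles, by which the cut-points in the
  notion of direction are the vertices counted by the Parity Condition. Off \<open>I\<close> all
  edges at \<open>w\<close> belong to \<open>C\<close>, and opening \<open>C\<close> at
  \<open>w\<close> disconnects nothing.\<close>

lemma cycle_cut_point_int:
  assumes C: "C \<in> Cs" and w: "w \<in> vertices_of T C" and cut: "cut_point T w"
  shows "w \<in> I"
proof (rule ccontr)
  assume nI: "w \<notin> I"
  obtain x where x: "x \<in> C" "w \<in> ends T x" using w unfolding vertices_of_def by blast
  have xT: "x \<in> edges T" using block_edges[OF cycle_block[OF C] x(1)] .
  have "w \<in> verts T" using xT x ends_verts by blast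
  then obtain D where D: "D \<in> Bs" "\<And>z. z \<in> edges T \<Longrightarrow> w \<in> ends T z \<Longrightarrow> z \<in> D"
    by (rule vertex_not_int[OF _ nI]) (rule that)
  have "D = C" using block_unique[OF D(1) cycle_block[OF C] D(2)[OF xT x(2)] x(1)] .
  then have "(Inr x, Inr z) \<in> conn T (verts T - {w})" if "z \<in> edges T" "w \<in> ends T z" for z
    using cycle_conn[OF cycle[OF C] ends_verts x(1)] D(2)[OF that] by simp
  then show False using not_cut_point[OF connected x(2) xT] cut by simp
qed

section \<open>Directions as local sign rules\<close>

text \<open>Every condition beyond the values being units is on a product of two arrows. Hence the
  rules survive a global reversal, two solutions have a constant ratio, and a reversal on part of
  the edges changes them by a computable sign.\<close>

definition sign_rule :: "('e \<Rightarrow> bool \<Rightarrow> int) \<Rightarrow> bool" where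
  "sign_rule \<epsilon> \<longleftrightarrow> (\<forall>B\<in>Bs. follows T B \<tau> \<epsilon>) \<and>
     (\<forall>A\<in>Bs. \<forall>B\<in>Bs. A \<noteq> B \<longrightarrow> (\<forall>x\<in>A. \<forall>y\<in>B. \<forall>c d. endpt T x c = endpt T y d \<longrightarrow> \<epsilon> x c * \<epsilon> y d = -1))"

lemma follows_unit: "follows T B \<sigma> \<epsilon> \<Longrightarrow> x \<in> B \<Longrightarrow> \<epsilon> x c \<in> {1, -1}"
  and follows_edge: "follows T B \<sigma> \<epsilon> \<Longrightarrow> x \<in> B \<Longrightarrow> \<epsilon> x False * \<epsilon> x True = - sign T x"
  and follows_vertex: "follows T B \<sigma> \<epsilon> \<Longrightarrow> x \<in> B \<Longrightarrow> y \<in> B \<Longrightarrow> endpt T x c = w \<Longrightarrow> endpt T y d = w \<Longrightarrow>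
    (x, c) \<noteq> (y, d) \<Longrightarrow> \<epsilon> x c * \<epsilon> y d = \<sigma> w"
  unfolding follows_def by auto

lemma follows_int_eq:
  assumes f: "follows T B \<tau> \<epsilon>" and w: "w \<in> I"
    and x: "x \<in> B" "endpt T x c = w" and y: "y \<in> B" "endpt T y d = w"
  shows "\<epsilon> x c = \<epsilon> y d"
proof (cases "(x, c) = (y, d)")
  case False
  then have "\<epsilon> x c * \<epsilon> y d = 1" using follows_vertex[OF f x(1) y(1) x(2) y(2)] w by (simp add: \<tau>_def)
  then show ?thesis using follows_unit[OF f x(1), of c] follows_unit[OF f y(1), of d] by auto
qed simp

lemma in_ends: "endpt T x c = w \<Longrightarrow> w \<in> ends T x"
  unfolding in_ends_iff by blast

text \<open>The upper bounds on what meets at a vertex turn the absence of sinks and sources into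
  equations. Off \<open>I\<close> there are two half-edges, which must differ. On \<open>I\<close>
  each of the two blocks has a constant arrow, and the two constants must differ.\<close>

lemma direction_sign_rule:
  assumes "direction T Cs \<epsilon>"
  shows "sign_rule \<epsilon>"
proof -
  have u: "\<epsilon> x c \<in> {1, -1}" and e: "\<epsilon> x False * \<epsilon> x True = - sign T x" if "x \<in> edges T" for x c
    using assms that unfolding direction_def orientation_def by auto
  have mixed: "\<not> sink_on T \<epsilon> (edges T) w" "\<not> source_on T \<epsilon> (edges T) w" if "w \<in> verts T" for w
    using assms that unfolding direction_def by auto
  have same: "sink_on T \<epsilon> C w \<or> source_on T \<epsilon> C w"
    if "C \<in> Cs" "w \<in> vertices_of T C" "w \<in> I" for C w
    using assms that int_cut unfolding direction_def by simp
  have cyc: "\<epsilon> x c = \<epsilon> y d" if B: "B \<in> Bs" and w: "w \<in> I"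
    and xy: "x \<in> B" "y \<in> B" "endpt T x c = w" "endpt T y d = w" for B x y c d w
    using B
  proof (rule block_cases)
    assume C: "B \<in> Cs"
    have "w \<in> vertices_of T B" using cycle_vertex[OF xy(1), of c] xy(3) by simp
    then show ?thesis using same[OF C _ w] xy unfolding sink_on_def source_on_def by auto
  next
    fix vs es assume "(vs, es) \<in> Ps" "B = set es"
    then show ?thesis using path_int_half_edge_unique[OF _ w, of vs es x c y d] xy by simp
  qed
  have const: False if w: "w \<in> verts T" and eq: "\<And>z k. z \<in> edges T \<Longrightarrow> endpt T z k = w \<Longrightarrow> \<epsilon> z k = s"
    and s: "s \<in> {1, -1}" for w s
    using mixed[OF w] eq s unfolding sink_on_def source_on_def by auto
  have "follows T B \<tau> \<epsilon>" if B: "B \<in> Bs" for B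
    unfolding follows_def
  proof (intro conjI ballI allI impI)
    fix x assume x: "x \<in> B"
    have xT: "x \<in> edges T" using block_edges[OF B x] .
    show "\<epsilon> x c \<in> {1, -1}" for c using u[OF xT] .
    show "\<epsilon> x False * \<epsilon> x True = - sign T x" using e[OF xT] .
    fix y c d assume y: "y \<in> B" and ne: "(x, c) \<noteq> (y, d)" and eq: "endpt T x c = endpt T y d"
    have yT: "y \<in> edges T" using block_edges[OF B y] .
    define w where "w = endpt T y d"
    have wx: "endpt T x c = w" and wy: "endpt T y d = w" using eq w_def by auto
    have w: "w \<in> verts T" using ends_verts[OF xT] in_ends[OF wx] by blast
    show "\<epsilon> x c * \<epsilon> y d = \<tau> (endpt T x c)"
    proof (cases "w \<in> I")
      case True
      then show ?thesis using cyc[OF B True x y wx wy] unit_sq[OF u[OF yT, of d]] wx by (simp add: \<tau>_def)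
    next
      case False
      obtain D where D: "D \<in> Bs" "\<And>z. z \<in> edges T \<Longrightarrow> w \<in> ends T z \<Longrightarrow> z \<in> D"
        by (rule vertex_not_int[OF w False]) (rule that)
      have "D = B" using block_unique[OF D(1) B D(2)[OF xT in_ends[OF wx]] x] .
      then have two: "(z, k) = (x, c) \<or> (z, k) = (y, d)" if "z \<in> edges T" "endpt T z k = w" for z k
        using block_half_edges_le_2[OF B x y D(2)[OF that(1) in_ends[OF that(2)], unfolded \<open>D = B\<close>] wx wy that(2)] ne
        by auto
      have "\<epsilon> x c \<noteq> \<epsilon> y d"
      proof
        assume s: "\<epsilon> x c = \<epsilon> y d"
        show False
          by (rule const[OF w _ u[OF xT, of c]]) (use two s in auto)
      qed
      then show ?thesis using u[OF xT, of c] u[OF yT, of d] False wx by (auto simp: \<tau>_def)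
    qed
  qed
  moreover have "\<epsilon> x c * \<epsilon> y d = -1"
    if A: "A \<in> Bs" and B: "B \<in> Bs" and AB: "A \<noteq> B" and x: "x \<in> A" and y: "y \<in> B" and eq: "endpt T x c = endpt T y d"
    for A B x y c d
  proof -
    define w where "w = endpt T y d"
    have wx: "endpt T x c = w" and wy: "endpt T y d = w" using eq w_def by auto
    have xT: "x \<in> edges T" and yT: "y \<in> edges T" using block_edges[OF A x] block_edges[OF B y] .
    have w: "w \<in> verts T" using ends_verts[OF xT] in_ends[OF wx] by blast
    have I: "w \<in> I" using blocks_meet_int[OF A B AB x y in_ends[OF wx] in_ends[OF wy]] .
    have all: "\<epsilon> z k = \<epsilon> x c \<or> \<epsilon> z k = \<epsilon> y d" if z: "z \<in> edges T" "endpt T z k = w" for z k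
      using z(1)
    proof (rule edge_block)
      fix D assume D: "D \<in> Bs" "z \<in> D"
      then have "D = A \<or> D = B"
        using blocks_at_vertex_le_2[OF A B AB x y in_ends[OF wx] in_ends[OF wy] D in_ends[OF z(2)]] by blast
      then show ?thesis using cyc[OF A I _ x z(2) wx] cyc[OF B I _ y z(2) wy] D(2) by auto
    qed
    have "\<epsilon> x c \<noteq> \<epsilon> y d"
    proof
      assume s: "\<epsilon> x c = \<epsilon> y d"
      show False
        by (rule const[OF w _ u[OF xT, of c]]) (use all s in auto)
    qed
    then show ?thesis using u[OF xT, of c] u[OF yT, of d] by auto
  qed
  ultimately show ?thesis unfolding sign_rule_def by simp
qed

text \<open>Here the lower bounds matter: two blocks at a vertex of \<open>I\<close>, or two
  half-edges at any other vertex, give a pair with product \<open>-1\<close>, which excludes both a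
  sink and a source.\<close>

lemma sign_rule_direction:
  assumes r: "sign_rule \<epsilon>"
  shows "direction T Cs \<epsilon>"
proof -
  have f: "follows T B \<tau> \<epsilon>" if "B \<in> Bs" for B using r that unfolding sign_rule_def by simp
  have diff: "\<epsilon> x c * \<epsilon> y d = -1"
    if "A \<in> Bs" "B \<in> Bs" "A \<noteq> B" "x \<in> A" "y \<in> B" "endpt T x c = w" "endpt T y d = w" for A B x y c d w
    using r that unfolding sign_rule_def by simp
  have "orientation T \<epsilon>"
    unfolding orientation_def
  proof
    fix x assume "x \<in> edges T"
    then show "(\<forall>b. \<epsilon> x b \<in> {1, -1}) \<and> \<epsilon> x False * \<epsilon> x True = - sign T x"
      by (rule edge_block) (use follows_unit[OF f] follows_edge[OF f] in auto)
  qed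
  moreover have "\<not> sink_on T \<epsilon> (edges T) w \<and> \<not> source_on T \<epsilon> (edges T) w" if w: "w \<in> verts T" for w
  proof -
    have "\<exists>x\<in>edges T. \<exists>y\<in>edges T. \<exists>c d. endpt T x c = w \<and> endpt T y d = w \<and> \<epsilon> x c * \<epsilon> y d = -1"
    proof (cases "w \<in> I")
      case True
      then obtain A B x y where AB: "A \<in> Bs" "B \<in> Bs" "A \<noteq> B" "x \<in> A" "y \<in> B" "w \<in> ends T x" "w \<in> ends T y"
        by (rule vertex_int) (rule that)
      obtain c where c: "endpt T x c = w" using AB(6) unfolding in_ends_iff ..
      obtain d where d: "endpt T y d = w" using AB(7) unfolding in_ends_iff ..
      show ?thesis
        by (rule bexI[OF _ block_edges[OF AB(1,4)]], rule bexI[OF _ block_edges[OF AB(2,5)]], intro exI conjI)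
          (rule c, rule d, rule diff[OF AB(1-5) c d])
    next
      case False
      obtain B x c y d where B: "B \<in> Bs" "x \<in> B" "y \<in> B" "(x, c) \<noteq> (y, d)" "endpt T x c = w" "endpt T y d = w"
        by (rule vertex_not_int[OF w False]) (rule that)
      have m: "\<epsilon> x c * \<epsilon> y d = -1"
        using follows_vertex[OF f[OF B(1)] B(2,3,5,6,4)] False by (simp add: \<tau>_def)
      show ?thesis
        by (rule bexI[OF _ block_edges[OF B(1,2)]], rule bexI[OF _ block_edges[OF B(1,3)]], intro exI conjI)
          (rule B(5), rule B(6), rule m)
    qed
    then obtain x y c d where "x \<in> edges T" "y \<in> edges T" "endpt T x c = w" "endpt T y d = w" "\<epsilon> x c * \<epsilon> y d = -1"
      by (elim bexE exE conjE)
    then show ?thesis unfolding sink_on_def source_on_def by fastforce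
  qed
  moreover have "sink_on T \<epsilon> C w \<or> source_on T \<epsilon> C w"
    if C: "C \<in> Cs" and w: "w \<in> vertices_of T C" and cut: "cut_point T w" for C w
  proof -
    have I: "w \<in> I" using cycle_cut_point_int[OF C w cut] .
    obtain x c where x: "x \<in> C" "endpt T x c = w" using w unfolding vertices_of_def ends_def by blast
    have F: "follows T C \<tau> \<epsilon>" using f[OF cycle_block[OF C]] .
    have "\<epsilon> y d = \<epsilon> x c" if "y \<in> C" "endpt T y d = w" for y d
      using follows_int_eq[OF F I that x] .
    then show ?thesis using follows_unit[OF F x(1), of c] unfolding sink_on_def source_on_def by auto
  qed
  ultimately show ?thesis unfolding direction_def by simp
qed

section \<open>Uniqueness up to opposite sign\<close>

lemma follows_cong:
  assumes "\<And>x c. x \<in> B \<Longrightarrow> \<epsilon> x c = \<epsilon>' x c"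
  shows "follows T B \<sigma> \<epsilon> \<longleftrightarrow> follows T B \<sigma> \<epsilon>'"
  using assms unfolding follows_def by simp

lemma sign_rule_cong:
  assumes "same_orientation T \<epsilon> \<epsilon>'" and "sign_rule \<epsilon>'"
  shows "sign_rule \<epsilon>"
proof -
  have eq: "\<epsilon> x c = \<epsilon>' x c" if "B \<in> Bs" "x \<in> B" for B x c
    using assms(1) block_edges[OF that] unfolding same_orientation_def by simp
  have "follows T B \<tau> \<epsilon>" if "B \<in> Bs" for B
    using assms(2) that follows_cong[of B \<epsilon> \<epsilon>' \<tau>] eq[OF that] unfolding sign_rule_def by simp
  then show ?thesis using assms(2) eq unfolding sign_rule_def by simp
qed

lemma sign_rule_uminus:
  assumes "sign_rule \<epsilon>"
  shows "sign_rule (\<lambda>x c. - \<epsilon> x c)"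
proof -
  have "- z \<in> {1, -1} \<longleftrightarrow> z \<in> {1, -1}" for z :: int by auto
  then have "follows T B \<tau> (\<lambda>x c. - \<epsilon> x c) \<longleftrightarrow> follows T B \<tau> \<epsilon>" for B
    unfolding follows_def minus_mult_minus by presburger
  then show ?thesis using assms unfolding sign_rule_def by simp
qed

lemma sign_rule_unique:
  assumes r: "sign_rule \<epsilon>" and r': "sign_rule \<epsilon>'"
  shows "same_orientation T \<epsilon>' \<epsilon> \<or> same_orientation T \<epsilon>' (\<lambda>x c. - \<epsilon> x c)"
proof (cases "edges T = {}")
  case True then show ?thesis unfolding same_orientation_def by simp
next
  case False
  then obtain x0 where x0: "x0 \<in> edges T" by blast
  \<comment> \<open>The ratio of the two solutions, as all values are units. Both obey the same
    product rules, so it does not change across an edge or at a vertex.\<close>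
  define \<rho> where "\<rho> x c = \<epsilon> x c * \<epsilon>' x c" for x c
  have f: "follows T B \<tau> \<epsilon>" "follows T B \<tau> \<epsilon>'" if "B \<in> Bs" for B
    using r r' that unfolding sign_rule_def by simp_all
  have diff: "\<epsilon> x c * \<epsilon> y d = -1" "\<epsilon>' x c * \<epsilon>' y d = -1"
    if "A \<in> Bs" "B \<in> Bs" "A \<noteq> B" "x \<in> A" "y \<in> B" "endpt T x c = w" "endpt T y d = w" for A B x y c d w
    using r r' that unfolding sign_rule_def by simp_all
  have u: "\<epsilon> x c \<in> {1, -1}" "\<epsilon>' x c \<in> {1, -1}" and e: "\<rho> x False = \<rho> x True" if "x \<in> edges T" for x c
  proof -
    obtain B where B: "B \<in> Bs" "x \<in> B" using edge_block[OF \<open>x \<in> edges T\<close>] .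
    have u: "\<epsilon> x c \<in> {1, -1}" "\<epsilon>' x c \<in> {1, -1}" for c
      using follows_unit[OF f(1)[OF B(1)] B(2)] follows_unit[OF f(2)[OF B(1)] B(2)] by auto
    then show "\<epsilon> x c \<in> {1, -1}" "\<epsilon>' x c \<in> {1, -1}" by auto
    show "\<rho> x False = \<rho> x True"
      using follows_edge[OF f(1)[OF B(1)] B(2)] follows_edge[OF f(2)[OF B(1)] B(2)]
        u[of False] u[of True] by (auto simp: \<rho>_def)
  qed
  have vertex: "\<rho> x c = \<rho> y d"
    if x: "x \<in> edges T" "endpt T x c = w" and y: "y \<in> edges T" "endpt T y d = w" for x y c d w
  proof -
    obtain A where A: "A \<in> Bs" "x \<in> A" using edge_block[OF x(1)] .
    obtain B where B: "B \<in> Bs" "y \<in> B" using edge_block[OF y(1)] .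
    have "\<epsilon> x c * \<epsilon> y d = \<epsilon>' x c * \<epsilon>' y d" if ne: "(x, c) \<noteq> (y, d)"
    proof (cases "A = B")
      case True
      then have y': "y \<in> A" using B(2) by simp
      show ?thesis
        unfolding follows_vertex[OF f(1)[OF A(1)] A(2) y' x(2) y(2) ne]
          follows_vertex[OF f(2)[OF A(1)] A(2) y' x(2) y(2) ne] ..
    next
      case False
      then show ?thesis using diff[OF A(1) B(1) _ A(2) B(2) x(2) y(2)] by simp
    qed
    then have "(x, c) = (y, d) \<or> \<epsilon> x c * \<epsilon> y d = \<epsilon>' x c * \<epsilon>' y d" by blast
    then show ?thesis
      using u[OF x(1), of c] u[OF y(1), of d] by (auto simp: \<rho>_def)
  qed
  define s where "s = \<rho> x0 True"
  \<comment> \<open>Connections alternate between vertices and edges, so the invariant has a form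
    for each: at an edge it covers both ends, at a vertex all half-edges attached there.\<close>
  have "(\<forall>x. y = Inr x \<longrightarrow> x \<in> edges T \<longrightarrow> (\<forall>c. \<rho> x c = s)) \<and>
      (\<forall>w. y = Inl w \<longrightarrow> (\<forall>x\<in>edges T. \<forall>c. endpt T x c = w \<longrightarrow> \<rho> x c = s))"
    if "(Inr x0, y) \<in> conn T (verts T)" for y
    using that unfolding conn_def
  proof (induction rule: rtrancl_induct)
    case base
    have "\<rho> x0 c = s" for c using e[OF x0] by (cases c) (simp_all add: s_def)
    then show ?case by simp
  next
    case (step y z)
    consider u x where "y = Inl u" "z = Inr x" "x \<in> edges T" "u \<in> ends T x"
      | u x where "y = Inr x" "z = Inl u" "x \<in> edges T" "u \<in> ends T x"
      using step.hyps(2) unfolding incidence_def by auto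
    then show ?case
    proof cases
      case 1
      obtain k where k: "endpt T x k = u" using 1(4) unfolding in_ends_iff ..
      have "\<rho> x k = s" using step.IH 1 k by simp
      then have "\<rho> x c = s" for c using e[OF 1(3)] by (cases c; cases k) simp_all
      then show ?thesis using 1 by simp
    next
      case 2
      obtain k where k: "endpt T x k = u" using 2(4) unfolding in_ends_iff ..
      have "\<rho> x k = s" using step.IH 2 by simp
      then have "\<rho> y c = s" if "y \<in> edges T" "endpt T y c = u" for y c
        using vertex[OF that 2(3) k] by simp
      then show ?thesis using 2 by simp
    qed
  qed
  moreover have "(Inr x0, Inr x) \<in> conn T (verts T)" if "x \<in> edges T" for x
    using connected_graph_conn[OF connected] x0 that by auto
  ultimately have s: "\<epsilon> x c * \<epsilon>' x c = s" if "x \<in> edges T" for x c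
    using that unfolding \<rho>_def by blast
  have "s = 1 \<or> s = -1" using s[OF x0, of True] u[OF x0, of True] by auto
  then show ?thesis
  proof
    assume "s = 1"
    then have "\<epsilon>' x c = \<epsilon> x c" if "x \<in> edges T" for x c
      using s[OF that, of c] u[OF that, of c] by auto
    then show ?thesis unfolding same_orientation_def by simp
  next
    assume "s = -1"
    then have "\<epsilon>' x c = - \<epsilon> x c" if "x \<in> edges T" for x c
      using s[OF that, of c] u[OF that, of c] by auto
    then show ?thesis unfolding same_orientation_def by simp
  qed
qed

section \<open>The Parity Condition and the existence of a direction\<close>

lemma parity_iff:
  "parity_condition T Cs Ps \<longleftrightarrow> (\<forall>C\<in>Cs. \<exists>\<epsilon>. follows T C \<tau> \<epsilon>)"
proof -
  have \<tau>: "\<tau> = (\<lambda>w. if w \<in> I then 1 else -1)" by (rule ext) (simp add: \<tau>_def)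
  have "(\<exists>\<epsilon>. follows T C \<tau> \<epsilon>) \<longleftrightarrow> (balanced T C \<longleftrightarrow> even (card (vertices_of T C \<inter> I)))" if "C \<in> Cs" for C
    unfolding \<tau> by (rule cycle_follows_iff[OF cycle[OF that] sign_unit])
  then show ?thesis unfolding parity_condition_def I_def[symmetric] by blast
qed

lemma block_follows:
  assumes par: "parity_condition T Cs Ps" and B: "B \<in> Bs"
  shows "\<exists>\<epsilon>. follows T B \<tau> \<epsilon>"
  using B
proof (rule block_cases)
  assume "B \<in> Cs" then show ?thesis using par unfolding parity_iff by simp
next
  fix vs es assume p: "(vs, es) \<in> Ps" "B = set es"
  obtain b where ch: "edge_chain T (length es) ((!) vs) ((!) es) b" and inj: "inj_on ((!) vs) {..length es}"
    using path_chain[OF path_simple[OF p(1)]] .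
  \<comment> \<open>A path never closes, so propagation along it meets no product condition.\<close>
  have "vs ! length es \<notin> (!) vs ` {..<length es}"
    using inj_onD[OF inj, of "length es"] by fastforce
  moreover have "B = (!) es ` {..<length es}" using p(2) by (auto simp: set_conv_nth)
  moreover have "\<tau> w \<in> {1, -1}" for w by (simp add: \<tau>_def)
  ultimately show ?thesis using chain_follows[OF ch sign_unit, of \<tau>] by simp
qed

text \<open>
  Start from any solution inside the blocks.  For every intersection vertex at which it fails,
  reverse all arrows on one side of the vertex: as the vertex is a cut-point, its two blocks lie on
  different sides, while no other vertex is affected.
\<close>

lemma sign_rule_exists:
  assumes par: "parity_condition T Cs Ps"
  shows "\<exists>\<epsilon>. sign_rule \<epsilon>"
proof -
  have "\<forall>B\<in>Bs. \<exists>\<epsilon>. follows T B \<tau> \<epsilon>" using block_follows[OF par] by blast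
  then obtain E where E: "\<forall>B\<in>Bs. follows T B \<tau> (E B)" by (rule bchoice[elim_format]) (elim exE)
  \<comment> \<open>The separate solutions combine into one function because every edge lies in a
    unique block.\<close>
  define \<epsilon>\<^sub>0 where "\<epsilon>\<^sub>0 x = E (THE B. B \<in> Bs \<and> x \<in> B) x" for x
  have f: "follows T B \<tau> \<epsilon>\<^sub>0" if B: "B \<in> Bs" for B
  proof -
    have "(THE B. B \<in> Bs \<and> x \<in> B) = B" if "x \<in> B" for x
      using B that block_unique by (intro the_equality) auto
    then have "\<epsilon>\<^sub>0 x c = E B x c" if "x \<in> B" for x c using that by (simp add: \<epsilon>\<^sub>0_def)
    then show ?thesis using E B follows_cong[of B \<epsilon>\<^sub>0 "E B"] by simp
  qed
  define bad where "bad w \<longleftrightarrow> (\<exists>A\<in>Bs. \<exists>B\<in>Bs. \<exists>x\<in>A. \<exists>y\<in>B. \<exists>c d. A \<noteq> B \<and>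
    endpt T x c = w \<and> endpt T y d = w \<and> \<epsilon>\<^sub>0 x c * \<epsilon>\<^sub>0 y d = 1)" for w
  \<comment> \<open>One pair decides for all: only two blocks meet at \<open>w\<close>, and on each
    of them \<open>\<epsilon>\<^sub>0\<close> is constant at \<open>w\<close>.\<close>
  have cross: "\<epsilon>\<^sub>0 x c * \<epsilon>\<^sub>0 y d = (if bad w then 1 else -1)"
    if AB: "A \<in> Bs" "B \<in> Bs" "A \<noteq> B" "x \<in> A" "y \<in> B" and w: "endpt T x c = w" "endpt T y d = w"
    for A B x y c d w
  proof (cases "bad w")
    case False
    have "\<epsilon>\<^sub>0 x c * \<epsilon>\<^sub>0 y d \<noteq> 1"
    proof
      assume "\<epsilon>\<^sub>0 x c * \<epsilon>\<^sub>0 y d = 1"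
      then have "bad w" unfolding bad_def
        using AB w by (intro bexI[of _ A] bexI[of _ B] bexI[of _ x] bexI[of _ y] exI[of _ c] exI[of _ d]) simp_all
      then show False using False by simp
    qed
    then show ?thesis
      using follows_unit[OF f[OF AB(1)] AB(4), of c] follows_unit[OF f[OF AB(2)] AB(5), of d] False by auto
  next
    case True
    then obtain A' B' x' y' c' d' where AB': "A' \<in> Bs" "B' \<in> Bs" "x' \<in> A'" "y' \<in> B'" "A' \<noteq> B'"
      "endpt T x' c' = w" "endpt T y' d' = w" "\<epsilon>\<^sub>0 x' c' * \<epsilon>\<^sub>0 y' d' = 1"
      unfolding bad_def by (elim bexE exE conjE)
    have w': "w \<in> ends T x" "w \<in> ends T y" "w \<in> ends T x'" "w \<in> ends T y'"
      using in_ends[OF w(1)] in_ends[OF w(2)] in_ends[OF AB'(6)] in_ends[OF AB'(7)] .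
    have I: "w \<in> I" using blocks_meet_int[OF AB w'(1,2)] .
    have "A' = A \<or> A' = B" using blocks_at_vertex_le_2[OF AB w'(1,2) AB'(1,3) w'(3)] .
    moreover have "B' = A \<or> B' = B" using blocks_at_vertex_le_2[OF AB w'(1,2) AB'(2,4) w'(4)] .
    ultimately consider "A' = A" "B' = B" | "A' = B" "B' = A" using AB'(5) by blast
    then have "\<epsilon>\<^sub>0 x c * \<epsilon>\<^sub>0 y d = 1"
    proof cases
      case 1
      have "\<epsilon>\<^sub>0 x c = \<epsilon>\<^sub>0 x' c'"
        using follows_int_eq[OF f[OF AB(1)] I AB(4) w(1) AB'(3)[unfolded 1] AB'(6)] .
      moreover have "\<epsilon>\<^sub>0 y d = \<epsilon>\<^sub>0 y' d'"
        using follows_int_eq[OF f[OF AB(2)] I AB(5) w(2) AB'(4)[unfolded 1] AB'(7)] .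
      ultimately show ?thesis using AB'(8) by simp
    next
      case 2
      have "\<epsilon>\<^sub>0 x c = \<epsilon>\<^sub>0 y' d'"
        using follows_int_eq[OF f[OF AB(1)] I AB(4) w(1) AB'(4)[unfolded 2] AB'(7)] .
      moreover have "\<epsilon>\<^sub>0 y d = \<epsilon>\<^sub>0 x' c'"
        using follows_int_eq[OF f[OF AB(2)] I AB(5) w(2) AB'(3)[unfolded 2] AB'(6)] .
      ultimately show ?thesis using AB'(8) by (simp add: mult.commute)
    qed
    then show ?thesis using True by simp
  qed
  define W where "W = {w \<in> I. bad w}"
  have "W \<subseteq> verts T" using int_cut unfolding W_def cut_point_def by blast
  then have finW: "finite W" using finite_verts finite_subset by blast
  \<comment> \<open>A reference edge at \<open>w\<close>: the component of \<open>e0 w\<close> after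
    removing \<open>w\<close> keeps its arrows, everything else is reversed.\<close>
  define e0 where "e0 w = (SOME x. x \<in> edges T \<and> w \<in> ends T x)" for w
  define side :: "'v \<Rightarrow> 'e \<Rightarrow> int" where
    "side w x = (if (Inr (e0 w), Inr x) \<in> conn T (verts T - {w}) then 1 else -1)" for w x
  have side_unit: "side w x \<in> {1, -1}" for w x by (simp add: side_def)
  have side_eq: "side w x = side w y" if "(Inr x, Inr y) \<in> conn T (verts T - {w})" for w x y
    using conn_trans[OF _ that] conn_trans[OF _ conn_sym[OF that]] unfolding side_def by metis
  have side_diff: "side w x * side w y = -1"
    if AB: "A \<in> Bs" "B \<in> Bs" "A \<noteq> B" "x \<in> A" "y \<in> B" and w: "w \<in> ends T x" "w \<in> ends T y"
    for A B x y w
  proof -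
    have I: "w \<in> I" using blocks_meet_int[OF AB w] .
    have e0: "e0 w \<in> edges T" "w \<in> ends T (e0 w)"
      using someI[of "\<lambda>x. x \<in> edges T \<and> w \<in> ends T x" x] block_edges[OF AB(1,4)] w(1)
      unfolding e0_def by auto
    obtain D where D: "D \<in> Bs" "e0 w \<in> D" using edge_block[OF e0(1)] .
    have "D = A \<or> D = B" using blocks_at_vertex_le_2[OF AB w D e0(2)] .
    then show ?thesis
    proof
      assume "D = A"
      then have "e0 w \<in> A" using D by simp
      then have "side w x = 1" using block_conn[OF I AB(1) _ e0(2) AB(4) w(1)] by (simp add: side_def)
      moreover have "side w y = -1"
        using blocks_not_conn[OF AB(1) \<open>e0 w \<in> A\<close> e0(2) AB(2,5) w(2) AB(3)] by (simp add: side_def)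
      ultimately show ?thesis by simp
    next
      assume "D = B"
      then have "e0 w \<in> B" using D by simp
      then have "side w y = 1" using block_conn[OF I AB(2) _ e0(2) AB(5) w(2)] by (simp add: side_def)
      moreover have "side w x = -1"
        using blocks_not_conn[OF AB(2) \<open>e0 w \<in> B\<close> e0(2) AB(1,4) w(1) AB(3)[symmetric]] by (simp add: side_def)
      ultimately show ?thesis by simp
    qed
  qed
  \<comment> \<open>All reversals together; as they are factors \<open>1\<close> and
    \<open>-1\<close>, their order does not matter.\<close>
  define F where "F x = (\<Prod>w\<in>W. side w x)" for x
  have F_unit: "F x \<in> {1, -1}" for x
    using finW unfolding F_def
  proof (induction W rule: finite_induct)
    case (insert w W) then show ?case using side_unit[of w x] by auto
  qed simp
  have F_same: "F x = F y" if B: "B \<in> Bs" "x \<in> B" "y \<in> B" and w: "w \<in> ends T x" "w \<in> ends T y" for B x y w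
    unfolding F_def
  proof (rule prod.cong[OF refl])
    fix u assume "u \<in> W"
    then have "u \<in> I" by (simp add: W_def)
    then show "side u x = side u y" by (rule side_eq[OF block_conn[OF _ B(1,2) w(1) B(3) w(2)]])
  qed
  have F_diff: "F x * F y = (if bad w then -1 else 1)"
    if AB: "A \<in> Bs" "B \<in> Bs" "A \<noteq> B" "x \<in> A" "y \<in> B" and w: "w \<in> ends T x" "w \<in> ends T y"
    for A B x y w
  proof -
    have "F x * F y = (\<Prod>u\<in>W. side u x * side u y)" by (simp add: F_def prod.distrib)
    \<comment> \<open>Removing any \<open>u\<close> other than \<open>w\<close> leaves
      \<open>x\<close> and \<open>y\<close> joined through \<open>w\<close>, so only the reversal at
      \<open>w\<close> itself distinguishes them.\<close>
    also have "\<dots> = (\<Prod>u\<in>W. if u = w then -1 else 1)"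
    proof (rule prod.cong[OF refl])
      fix u assume "u \<in> W"
      show "side u x * side u y = (if u = w then -1 else 1)"
      proof (cases "u = w")
        case True then show ?thesis using side_diff[OF AB w] by simp
      next
        case False
        have "x \<in> edges T" "y \<in> edges T" using block_edges[OF AB(1,4)] block_edges[OF AB(2,5)] .
        moreover have "w \<in> verts T - {u}" using False ends_verts[OF \<open>x \<in> edges T\<close>] w(1) by blast
        ultimately have "side u x = side u y" using w by (intro side_eq conn_adjacent[of w])
        then show ?thesis using unit_sq[OF side_unit[of u y]] False by simp
      qed
    qed
    also have "\<dots> = (if w \<in> W then -1 else 1)" using finW by (rule prod.delta)
    finally show ?thesis using blocks_meet_int[OF AB w] by (simp add: W_def)
  qed
  define \<epsilon> where "\<epsilon> x c = F x * \<epsilon>\<^sub>0 x c" for x c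
  have prod_\<epsilon>: "\<epsilon> x c * \<epsilon> y d = (F x * F y) * (\<epsilon>\<^sub>0 x c * \<epsilon>\<^sub>0 y d)" for x y c d
    by (simp add: \<epsilon>_def ac_simps)
  have "follows T B \<tau> \<epsilon>" if B: "B \<in> Bs" for B
    unfolding follows_def
  proof (intro conjI ballI allI impI)
    fix x assume x: "x \<in> B"
    show "\<epsilon> x c \<in> {1, -1}" for c
      using F_unit[of x] follows_unit[OF f[OF B] x, of c] by (auto simp: \<epsilon>_def)
    show "\<epsilon> x False * \<epsilon> x True = - sign T x"
      unfolding prod_\<epsilon> unit_sq[OF F_unit] using follows_edge[OF f[OF B] x] by simp
    fix y c d assume y: "y \<in> B" and ne: "(x, c) \<noteq> (y, d)" and eq: "endpt T x c = endpt T y d"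
    have "F x = F y" using F_same[OF B x y in_ends[OF eq] in_ends[OF refl]] .
    then show "\<epsilon> x c * \<epsilon> y d = \<tau> (endpt T x c)"
      unfolding prod_\<epsilon> using unit_sq[OF F_unit[of y]] follows_vertex[OF f[OF B] x y refl eq[symmetric] ne]
      by simp
  qed
  \<comment> \<open>The factor from \<open>F\<close> is \<open>-1\<close> exactly at the bad
    vertices, where the old product was \<open>1\<close> instead of \<open>-1\<close>.\<close>
  moreover have "\<epsilon> x c * \<epsilon> y d = -1"
    if AB: "A \<in> Bs" "B \<in> Bs" "A \<noteq> B" "x \<in> A" "y \<in> B" and eq: "endpt T x c = endpt T y d" for A B x y c d
    unfolding prod_\<epsilon> cross[OF AB eq refl] F_diff[OF AB in_ends[OF eq] in_ends[OF refl]] by simp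
  ultimately have "sign_rule \<epsilon>" unfolding sign_rule_def by simp
  then show ?thesis by (rule exI[of _ \<epsilon>])
qed

lemma direction_iff: "direction T Cs \<epsilon> \<longleftrightarrow> sign_rule \<epsilon>"
  using direction_sign_rule sign_rule_direction by blast

lemma parity_iff_direction: "parity_condition T Cs Ps \<longleftrightarrow> (\<exists>\<epsilon>. direction T Cs \<epsilon>)"
proof
  assume "parity_condition T Cs Ps"
  then show "\<exists>\<epsilon>. direction T Cs \<epsilon>" unfolding direction_iff by (rule sign_rule_exists)
next
  assume "\<exists>\<epsilon>. direction T Cs \<epsilon>"
  then obtain \<epsilon> where "sign_rule \<epsilon>" unfolding direction_iff by (elim exE)
  then have "follows T C \<tau> \<epsilon>" if "C \<in> Cs" for C
    using cycle_block[OF that] unfolding sign_rule_def by simp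
  then show "parity_condition T Cs Ps" unfolding parity_iff by (intro ballI exI)
qed

lemma direction_unique:
  assumes "direction T Cs \<epsilon>"
  shows "direction T Cs \<epsilon>' \<longleftrightarrow> same_orientation T \<epsilon>' \<epsilon> \<or> same_orientation T \<epsilon>' (\<lambda>x c. - \<epsilon> x c)"
proof -
  have r: "sign_rule \<epsilon>" using assms unfolding direction_iff .
  show ?thesis
    unfolding direction_iff
  proof
    assume "sign_rule \<epsilon>'"
    then show "same_orientation T \<epsilon>' \<epsilon> \<or> same_orientation T \<epsilon>' (\<lambda>x c. - \<epsilon> x c)"
      by (rule sign_rule_unique[OF r])
  next
    assume "same_orientation T \<epsilon>' \<epsilon> \<or> same_orientation T \<epsilon>' (\<lambda>x c. - \<epsilon> x c)"
    then show "sign_rule \<epsilon>'"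
      by (elim disjE) (erule sign_rule_cong, rule r sign_rule_uminus[OF r])+
  qed
qed

end

theorem theorem3p3:
  fixes G T :: "('v, 'e) sgraph"
    and Cs :: "'e set set" and Ps :: "('v list \<times> 'e list) set"
  assumes "signed_graph G"
    and "signed_subgraph T G"
    and "cycle_tree T Cs Ps"
  shows "(parity_condition T Cs Ps \<longleftrightarrow> (\<exists>\<epsilon>. direction T Cs \<epsilon>)) \<and>
         (\<forall>\<epsilon>. direction T Cs \<epsilon> \<longrightarrow>
            (\<forall>\<epsilon>'. direction T Cs \<epsilon>' \<longleftrightarrow>
               same_orientation T \<epsilon>' \<epsilon> \<or> same_orientation T \<epsilon>' (\<lambda>e b. - \<epsilon> e b)))"
proof -
  interpret block_tree T Cs Ps
    using assms unfolding signed_subgraph_def by unfold_locales auto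
  show ?thesis by (intro conjI allI impI parity_iff_direction direction_unique)
qed

end
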